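(* Let $r>0$ be fixed. There is a positive constant $c$, depending only on $r$, such that for any $\epsilon\in(0,1/2)$, for every $L\in\mathbb{N}$ with $rL\in\mathbb{N}$ and $L\geq c/\epsilon$, and for every $\eta\in\mathbb{Z}_+^L$ with $\sum_{x=1}^L\eta_x=rL$, the (configuration) mixing time $$t_{\mathrm{mix}}(\eta,\epsilon):=\inf\big\{t\geq0\colon \Vert \mathbb{P}_\eta(\eta(t)\in\cdot)-\nu\Vert<\epsilon\big\}$$ of the Repeated Balls-into-Bins process $(\eta(t))_{t\ge 0}$ with $L$ sites and $rL$ particles, with invariant measure $\nu$, satisfies $$t_{\mathrm{mix}}(\eta,\epsilon)\leq c\big(\Vert\eta\Vert_\infty+(\log L)^c\big).$$
   Context: $\mathbb{N}=\{1,2,\dots\}$, $\mathbb{Z}_+=\mathbb{N}\cup\{0\}$, $[L]=\{1,\dots,L\}$, and $\Vert\eta\Vert_\infty=\max_{x\in[L]}\eta_x$ for $\eta\in\mathbb{Z}_+^L$. $\Vert\mu-\nu\Vert$ denotes the total variation distance between probability measures. Repeated Balls-into-Bins (RBB) process with $L$ sites: let $U_y(t)$, $y\in[L]$, $t\in\mathbb{N}$, be i.i.d. random variables uniformly distributed on $[L]$. The discrete-time Markov chain $(\eta(t))_{t\in\mathbb{Z}_+}$ with values in $\mathbb{Z}_+^L$ is defined from an initial state $\eta(0)=\eta$ by $$\eta_x(t+1)=\eta_x(t)-\mathbf{1}_{\{\eta_x(t)>0\}}+\sum_{y=1}^L\mathbf{1}_{\{\eta_y(t)>0\}}\mathbf{1}_{\{U_y(t+1)=x\}},\qquad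 x\in[L].$$ The total number of particles $\sum_x\eta_x(t)$ is conserved. On the configurations with exactly $rL$ particles the chain is a finite irreducible (ergodic) Markov chain, and $\nu$ denotes its unique invariant probability measure. $\mathbb{P}_\eta$ is the law of the process started at $\eta(0)=\eta$. Time $t$ takes values in $\mathbb{Z}_+$. *)

theory Defs
  imports "HOL-Probability.Probability"
begin

text \<open>
  A configuration on the sites \<open>{1..L}\<close> is a function \<open>nat \<Rightarrow> nat\<close> that vanishes outside \<open>{1..L}\<close>,
  so that equality of configurations on \<open>{1..L}\<close> is equality of functions.
\<close>

definition rbb_configs :: "nat \<Rightarrow> nat \<Rightarrow> (nat \<Rightarrow> nat) set" where
  "rbb_configs L N = {\<eta>. (\<forall>x. x \<notin> {1..L} \<longrightarrow> \<eta> x = 0) \<and> (\<Sum>x=1..L. \<eta> x) = N}"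

definition max_occupancy :: "nat \<Rightarrow> (nat \<Rightarrow> nat) \<Rightarrow> nat" where
  "max_occupancy L \<eta> = Max (\<eta> ` {1..L})"

text \<open>
  The truncated subtraction in the next definition is exact.
\<close>

definition rbb_step :: "nat \<Rightarrow> (nat \<Rightarrow> nat) \<Rightarrow> (nat \<Rightarrow> nat) \<Rightarrow> (nat \<Rightarrow> nat)" where
  "rbb_step L u \<eta> = (\<lambda>x. if x \<in> {1..L}
     then \<eta> x - of_bool (\<eta> x > 0) + (\<Sum>y=1..L. of_bool (\<eta> y > 0) * of_bool (u y = x))
     else 0)"

text \<open>
  The trajectory driven by the destinations \<open>U (t, y)\<close>, written \<open>U\<^sub>y(t)\<close> in the usual notation.
\<close>

primrec rbb_path :: "nat \<Rightarrow> (nat \<times> nat \<Rightarrow> nat) \<Rightarrow> (nat \<Rightarrow> nat) \<Rightarrow> nat \<Rightarrow> (nat \<Rightarrow> nat)" where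
  "rbb_path L U \<eta> 0 = \<eta>"
| "rbb_path L U \<eta> (Suc t) = rbb_step L (\<lambda>y. U (Suc t, y)) (rbb_path L U \<eta> t)"

text \<open>
  The law of \<open>\<eta>(t)\<close> when the process starts from \<open>\<eta>\<close>. As \<open>\<eta>(t)\<close> only depends on the destinations
  up to time \<open>t\<close>, a finite product of uniform distributions suffices; the default value \<open>0\<close> outside
  the index set is never used. The lemma \<open>distr_rbb_path\<close> below identifies this with the law obtained
  from an infinite family of i.i.d. uniform destinations on an arbitrary probability space.
\<close>

definition rbb_law :: "nat \<Rightarrow> (nat \<Rightarrow> nat) \<Rightarrow> nat \<Rightarrow> (nat \<Rightarrow> nat) pmf" where
  "rbb_law L \<eta> t = map_pmf (\<lambda>U. rbb_path L U \<eta> t)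
     (Pi_pmf ({1..t} \<times> {1..L}) 0 (\<lambda>_. pmf_of_set {1..L}))"

definition rbb_invariant :: "nat \<Rightarrow> nat \<Rightarrow> (nat \<Rightarrow> nat) pmf \<Rightarrow> bool" where
  "rbb_invariant L N \<nu> \<longleftrightarrow>
     set_pmf \<nu> \<subseteq> rbb_configs L N \<and> bind_pmf \<nu> (\<lambda>\<eta>. rbb_law L \<eta> 1) = \<nu>"

definition tv_dist :: "'a pmf \<Rightarrow> 'a pmf \<Rightarrow> real" where
  "tv_dist \<mu> \<nu> = (SUP A. \<bar>measure_pmf.prob \<mu> A - measure_pmf.prob \<nu> A\<bar>)"

text \<open>
  The mixing time is \<open>enat\<close>-valued, so that the infimum of the empty set is \<open>\<infinity>\<close>.
\<close>

definition rbb_tmix :: "nat \<Rightarrow> (nat \<Rightarrow> nat) pmf \<Rightarrow> (nat \<Rightarrow> nat) \<Rightarrow> real \<Rightarrow> enat" where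
  "rbb_tmix L \<nu> \<eta> \<epsilon> = (INF t \<in> {t. tv_dist (rbb_law L \<eta> t) \<nu> < \<epsilon>}. enat t)"

lemma rbb_path_cong:
  assumes "\<And>s y. s \<in> {1..t} \<Longrightarrow> y \<in> {1..L} \<Longrightarrow> U (s, y) = V (s, y)"
  shows "rbb_path L U \<eta> t = rbb_path L V \<eta> t"
  using assms
proof (induction t)
  case (Suc t)
  have "rbb_path L U \<eta> t = rbb_path L V \<eta> t"
    by (rule Suc.IH) (use Suc.prems in auto)
  then show ?case
    using Suc.prems by (auto simp: rbb_step_def fun_eq_iff intro!: sum.cong)
qed simp

lemma distr_rbb_path:
  assumes M: "prob_space M"
    and indep: "prob_space.indep_vars M (\<lambda>_. count_space UNIV) U ({1..} \<times> {1..L})"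
    and unif: "\<And>i. i \<in> {1..} \<times> {1..L} \<Longrightarrow>
                 distr M (count_space UNIV) (U i) = measure_pmf (pmf_of_set {1..L})"
  shows "distr M (count_space UNIV) (\<lambda>\<omega>. rbb_path L (\<lambda>i. U i \<omega>) \<eta> t) = measure_pmf (rbb_law L \<eta> t)"
proof -
  interpret prob_space M by fact
  define I where "I = {1..t} \<times> {1..L}"
  define P where "P = Pi_pmf I 0 (\<lambda>_. pmf_of_set {1..L})"
  define g where "g = (\<lambda>f. rbb_path L f \<eta> t)"
  have g_restrict: "g (restrict f I) = g f" for f
    unfolding g_def by (rule rbb_path_cong) (auto simp: I_def)
  have law: "rbb_law L \<eta> t = map_pmf g P"
    by (simp add: rbb_law_def P_def g_def I_def)
  have fin: "finite I" by (simp add: I_def)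
  have I_sub: "I \<subseteq> {1..} \<times> {1..L}" by (auto simp: I_def)
  have indI: "indep_vars (\<lambda>_. count_space UNIV) U I"
    by (rule indep_vars_subset[OF indep I_sub])
  then have rv: "U i \<in> measurable M (count_space UNIV)" if "i \<in> I" for i
    using that by (auto simp: indep_vars_def)
  show ?thesis
  proof (cases "I = {}")
    case True
    have const: "g f = g (\<lambda>_. 0)" for f
      using g_restrict[of f] g_restrict[of "\<lambda>_. 0"] True by (simp add: restrict_def)
    have "distr M (count_space UNIV) (\<lambda>\<omega>. g (\<lambda>i. U i \<omega>)) = return (count_space UNIV) (g (\<lambda>_. 0))"
      by (subst const) (rule distr_const, simp)
    also have "\<dots> = measure_pmf (map_pmf g P)"
      by (subst (2) const[abs_def]) (simp add: map_pmf_const return_pmf.rep_eq)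
    finally show ?thesis by (simp add: law g_def)
  next
    case False
    let ?Q = "PiM I (\<lambda>_. count_space (UNIV :: nat set))"
    have Q: "?Q = count_space (PiE I (\<lambda>_. UNIV))"
      using fin by (rule count_space_PiM_finite) auto
    have g_meas: "g \<in> measurable ?Q (count_space UNIV)"
      unfolding Q by simp
    have "distr M ?Q (\<lambda>\<omega>. \<lambda>i\<in>I. U i \<omega>) = PiM I (\<lambda>i. distr M (count_space UNIV) (U i))"
      using indep_vars_iff_distr_eq_PiM'[OF False rv] indI by simp
    also have "\<dots> = PiM I (\<lambda>i. measure_pmf (pmf_of_set {1..L}))"
      by (rule PiM_cong) (use unif I_sub in auto)
    also have "\<dots> = PiM I (\<lambda>i. distr (measure_pmf P) (count_space UNIV) (\<lambda>f. f i))"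
    proof (rule PiM_cong)
      fix i assume "i \<in> I"
      then have "map_pmf (\<lambda>f. f i) P = pmf_of_set {1..L}"
        using fin by (simp add: P_def Pi_pmf_component)
      then show "measure_pmf (pmf_of_set {1..L}) = distr (measure_pmf P) (count_space UNIV) (\<lambda>f. f i)"
        by (metis map_pmf_rep_eq)
    qed simp
    also have "\<dots> = distr (measure_pmf P) ?Q (\<lambda>f. \<lambda>i\<in>I. f i)"
    proof -
      have "prob_space.indep_vars (measure_pmf P) (\<lambda>_. count_space UNIV) (\<lambda>i f. f i) I"
        unfolding P_def by (rule indep_vars_Pi_pmf[OF fin])
      then have "distr (measure_pmf P) ?Q (\<lambda>f. \<lambda>i\<in>I. f i) =
                 PiM I (\<lambda>i. distr (measure_pmf P) (count_space UNIV) (\<lambda>f. f i))"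
        by (subst (asm) prob_space.indep_vars_iff_distr_eq_PiM'[OF measure_pmf.prob_space_axioms False])
           simp_all
      then show ?thesis by (rule sym)
    qed
    finally have eq: "distr M ?Q (\<lambda>\<omega>. \<lambda>i\<in>I. U i \<omega>) = distr (measure_pmf P) ?Q (\<lambda>f. \<lambda>i\<in>I. f i)" .
    have "distr M (count_space UNIV) (\<lambda>\<omega>. g (\<lambda>i. U i \<omega>)) =
          distr (distr M ?Q (\<lambda>\<omega>. \<lambda>i\<in>I. U i \<omega>)) (count_space UNIV) g"
      by (subst distr_distr[OF g_meas])
         (auto intro!: measurable_restrict rv simp: o_def g_restrict)
    also have "\<dots> = distr (measure_pmf P) (count_space UNIV) g"
      unfolding eq
      by (subst distr_distr[OF g_meas])
         (auto intro!: measurable_restrict simp: o_def g_restrict space_PiM)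
    also have "\<dots> = measure_pmf (map_pmf g P)"
      by (simp add: map_pmf_rep_eq)
    finally show ?thesis by (simp add: law g_def)
  qed
qed

end

theory Submission
  imports Defs
begin

text \<open>
  Two configurations that differ in the position of a single ball can be written as \<open>\<xi> + \<delta>\<^sub>x\<close> and
  \<open>\<xi> + \<delta>\<^sub>y\<close> with a common background \<open>\<xi>\<close>. If the extra ball is always served last, then the background
  is itself a repeated balls-into-bins process, and the extra ball waits at its site until the
  background leaves this site empty; then it jumps to a uniformly chosen site. The two extra balls
  can be coupled such that they jump to a common site as soon as both of them jump in the same
  step, and then they stay together (\<open>pair_step\<close>). Hence the total variation distance of the two laws
  is at most the probability that the extra balls are still apart (\<open>adjacent_diff_le\<close>). Since any
  two configurations with \<open>N\<close> balls are joined by at most \<open>N\<close> moves of one ball (\<open>path_diff_le\<close>), it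
  suffices that this probability is of order \<open>\<rho> ^ t * L * exp (l * max \<xi>)\<close> with constants that depend on
  \<open>r\<close> only (\<open>apart_decay\<close>).

  The driving force is a drift. Half of the sites have at most \<open>K = \<lceil>2 * r\<rceil>\<close> balls, and each of
  them is empty \<open>K\<close> steps later with a probability bounded below. So from every configuration the mean
  fraction of empty sites after \<open>K\<close> steps is bounded below, and a site with many balls loses a definite
  amount on average over \<open>k = K + 1\<close> steps. For a small exponent \<open>l\<close> this yields
  \<open>E (exp (l * \<xi> z)) \<le> \<gamma> * exp (l * \<xi> z) + B\<close> over such a block (\<open>exp_moment_block_drift\<close>), from every
  configuration. The same holds for the sites
  of the extra balls; when one of them jumps, the exponential at its new position is in mean the
  average over all sites, which contracts as well. Therefore a weighted sum of the three quantities
  contracts up to a constant (\<open>pair_weight_drift\<close>).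

  Where this sum is bounded, both extra balls wait below a bounded number of balls, and a positive
  fraction of the sites is busy. Then, with a probability that does not depend on \<open>L\<close>, the arrivals of
  one step make the two sites equally high, and both drain without further arrivals, so that the
  extra balls jump together (\<open>small_set_meeting\<close>). Drift and meeting probability give the geometric
  decay (\<open>geometric_absorption\<close>).

  Finally the drift shows that an invariant law has bounded exponential moments
  (\<open>invariant_exp_moment\<close>). Averaging the second initial configuration over it bounds the distance to
  equilibrium after \<open>n\<close> blocks by a multiple of \<open>L\<^sup>2 * \<rho> ^ n * exp (l * max \<eta>)\<close> (\<open>tv_dist_decay\<close>), and this
  is below \<open>1 / L\<close> as soon as \<open>n\<close> exceeds a suitable multiple of \<open>max \<eta> + ln L\<close>.
\<close>

section \<open>Transition operators\<close>

definition dest_law :: "nat \<Rightarrow> (nat \<Rightarrow> nat) pmf" where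
  "dest_law L = Pi_pmf {1..L} 0 (\<lambda>_. pmf_of_set {1..L})"

text \<open>
  The one-step expectation, as an operator on functions of the state, for any process driven by the
  destinations. Iterates of this operator replace trajectories and conditional expectations below.
\<close>

definition step_op :: "nat \<Rightarrow> ((nat \<Rightarrow> nat) \<Rightarrow> 's \<Rightarrow> 's) \<Rightarrow> ('s \<Rightarrow> real) \<Rightarrow> 's \<Rightarrow> real" where
  "step_op L g f s = measure_pmf.expectation (dest_law L) (\<lambda>u. f (g u s))"

text \<open>
  Positivity is only required on the states that satisfy \<open>I\<close>; this spares all estimates from
  configurations that the process never visits.
\<close>

definition markov_op :: "('s \<Rightarrow> bool) \<Rightarrow> (('s \<Rightarrow> real) \<Rightarrow> 's \<Rightarrow> real) \<Rightarrow> bool" where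
  "markov_op I \<Phi> \<longleftrightarrow>
     (\<forall>f h a b c. \<Phi> (\<lambda>s. a * f s + b * h s + c) = (\<lambda>s. a * \<Phi> f s + b * \<Phi> h s + c)) \<and>
     (\<forall>f h s. (\<forall>s. I s \<longrightarrow> f s \<le> h s) \<longrightarrow> I s \<longrightarrow> \<Phi> f s \<le> \<Phi> h s)"

lemma set_dest_law: "set_pmf (dest_law L) \<subseteq> PiE_dflt {1..L} 0 (\<lambda>_. {1..L})"
proof
  fix u assume "u \<in> set_pmf (dest_law L)"
  then have *: "u \<in> PiE_dflt {1..L} 0 (set_pmf \<circ> (\<lambda>_. pmf_of_set {1..L}))"
    unfolding dest_law_def by (subst (asm) set_Pi_pmf) auto
  show "u \<in> PiE_dflt {1..L} 0 (\<lambda>_. {1..L})"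
  proof (cases "L = 0")
    case False
    then show ?thesis using * by (simp add: PiE_dflt_def set_pmf_of_set)
  qed (use * in \<open>simp add: PiE_dflt_def\<close>)
qed

lemma finite_dest_law: "finite (set_pmf (dest_law L))"
  by (rule finite_subset[OF set_dest_law]) auto

lemma integrable_dest_law [simp]: "integrable (measure_pmf (dest_law L)) (f :: _ \<Rightarrow> real)"
  by (rule integrable_measure_pmf_finite[OF finite_dest_law])

lemma dest_law_range: "u \<in> set_pmf (dest_law L) \<Longrightarrow> y \<in> {1..L} \<Longrightarrow> u y \<in> {1..L}"
  using set_dest_law[of L] by (auto simp: PiE_dflt_def)

lemma dest_expectation_mono:
  assumes "\<And>u. u \<in> set_pmf (dest_law L) \<Longrightarrow> f u \<le> (h u :: real)"
  shows "measure_pmf.expectation (dest_law L) f \<le> measure_pmf.expectation (dest_law L) h"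
  by (rule integral_mono_AE) (use assms in \<open>auto simp: AE_measure_pmf_iff\<close>)

lemma dest_expectation_cong:
  assumes "\<And>u. u \<in> set_pmf (dest_law L) \<Longrightarrow> f u = (h u :: real)"
  shows "measure_pmf.expectation (dest_law L) f = measure_pmf.expectation (dest_law L) h"
  by (rule integral_cong_AE) (use assms in \<open>auto simp: AE_measure_pmf_iff\<close>)

lemma step_op_cong:
  assumes "\<And>u. u \<in> set_pmf (dest_law L) \<Longrightarrow> f (g u s) = h (g' u s')"
  shows "step_op L g f s = step_op L g' h s'"
  unfolding step_op_def by (rule dest_expectation_cong) (use assms in auto)

lemma markov_op_step:
  assumes "\<And>u s. u \<in> set_pmf (dest_law L) \<Longrightarrow> I s \<Longrightarrow> I (g u s)"
  shows "markov_op I (step_op L g)"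
  unfolding markov_op_def step_op_def
  by (intro conjI allI impI ext dest_expectation_mono) (use assms in auto)

lemma markov_op_affine:
  "markov_op I \<Phi> \<Longrightarrow> \<Phi> (\<lambda>s. a * f s + b * h s + c) = (\<lambda>s. a * \<Phi> f s + b * \<Phi> h s + c)"
  unfolding markov_op_def by blast

lemma markov_op_mono:
  "markov_op I \<Phi> \<Longrightarrow> (\<And>s. I s \<Longrightarrow> f s \<le> h s) \<Longrightarrow> I s \<Longrightarrow> \<Phi> f s \<le> \<Phi> h s"
  unfolding markov_op_def by blast

lemma markov_op_le_affine:
  assumes "markov_op I \<Phi>" "\<And>s. I s \<Longrightarrow> f s \<le> a * h s + b * k s + c" "I s"
  shows "\<Phi> f s \<le> a * \<Phi> h s + b * \<Phi> k s + c"
  using markov_op_mono[OF assms] by (simp add: markov_op_affine[OF assms(1)])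

lemma markov_op_le_affine1:
  assumes "markov_op I \<Phi>" "\<And>s. I s \<Longrightarrow> f s \<le> a * h s + c" "I s"
  shows "\<Phi> f s \<le> a * \<Phi> h s + c"
  using markov_op_le_affine[OF assms(1), of f a h 0 h c s] assms(2,3) by simp

lemma markov_op_ge_affine1:
  assumes "markov_op I \<Phi>" "\<And>s. I s \<Longrightarrow> a * h s + c \<le> f s" "I s"
  shows "a * \<Phi> h s + c \<le> \<Phi> f s"
  using markov_op_mono[OF assms(1), of "\<lambda>s. a * h s + 0 * h s + c" f s] assms(2,3)
  unfolding markov_op_affine[OF assms(1)] by simp

lemma markov_op_const: "markov_op I \<Phi> \<Longrightarrow> \<Phi> (\<lambda>_. c) s = c"
  using markov_op_affine[of I \<Phi> 0 "\<lambda>_. 0" 0 "\<lambda>_. 0" c] by simp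

lemma markov_op_le_const:
  assumes "markov_op I \<Phi>" "\<And>s. I s \<Longrightarrow> f s \<le> c" "I s"
  shows "\<Phi> f s \<le> c"
  using markov_op_mono[OF assms(1), of f "\<lambda>_. c" s] assms by (simp add: markov_op_const[OF assms(1)])

lemma markov_op_ge_const:
  assumes "markov_op I \<Phi>" "\<And>s. I s \<Longrightarrow> c \<le> f s" "I s"
  shows "c \<le> \<Phi> f s"
  using markov_op_mono[OF assms(1), of "\<lambda>_. c" f s] assms by (simp add: markov_op_const[OF assms(1)])

lemma markov_op_sum:
  assumes "markov_op I \<Phi>" "finite Z"
  shows "\<Phi> (\<lambda>s. \<Sum>z\<in>Z. f z s) = (\<lambda>s. \<Sum>z\<in>Z. \<Phi> (f z) s)"
  using assms(2)
proof (induction Z rule: finite_induct)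
  case empty
  show ?case by (simp add: fun_eq_iff markov_op_const[OF assms(1)])
next
  case (insert z Z)
  then show ?case
    using markov_op_affine[OF assms(1), of 1 "f z" 1 "\<lambda>s. \<Sum>z\<in>Z. f z s" 0] by simp
qed

lemma markov_op_funpow:
  assumes "markov_op I \<Phi>"
  shows "markov_op I (\<Phi> ^^ n)"
proof (induction n)
  case 0
  show ?case by (simp add: markov_op_def)
next
  case (Suc n)
  show ?case unfolding markov_op_def
  proof (intro conjI allI impI)
    fix f h :: "'a \<Rightarrow> real" and a b c :: real
    show "(\<Phi> ^^ Suc n) (\<lambda>s. a * f s + b * h s + c) =
        (\<lambda>s. a * (\<Phi> ^^ Suc n) f s + b * (\<Phi> ^^ Suc n) h s + c)"
      by (simp add: markov_op_affine[OF Suc] markov_op_affine[OF assms])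
  next
    fix f h :: "'a \<Rightarrow> real" and s
    assume "\<forall>s. I s \<longrightarrow> f s \<le> h s" "I s"
    then show "(\<Phi> ^^ Suc n) f s \<le> (\<Phi> ^^ Suc n) h s"
      by (auto intro!: markov_op_mono[OF assms] markov_op_mono[OF Suc])
  qed
qed

text \<open>
  The additive constants are summed as a geometric series, so the bound is uniform in \<open>n\<close>.
\<close>

lemma markov_op_affine_iterate:
  assumes "markov_op I \<Phi>" "\<And>s. I s \<Longrightarrow> \<Phi> f s \<le> a * f s + b" "0 \<le> a" "a < 1" "0 \<le> b" "I s"
  shows "(\<Phi> ^^ n) f s \<le> a ^ n * f s + b / (1 - a)"
  using assms(6)
proof (induction n arbitrary: s)
  case (Suc n)
  have "(\<Phi> ^^ Suc n) f s \<le> a ^ n * \<Phi> f s + b / (1 - a)"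
    using markov_op_le_affine1[OF assms(1) Suc.IH Suc.prems] by simp
  also have "\<dots> \<le> a ^ n * (a * f s + b) + b / (1 - a)"
    using assms(2)[OF Suc.prems] assms(3) by (intro add_right_mono mult_left_mono) auto
  also have "\<dots> = a ^ Suc n * f s + (a ^ n * b + b / (1 - a))" by (simp add: algebra_simps)
  finally have *: "(\<Phi> ^^ Suc n) f s \<le> a ^ Suc n * f s + (a ^ n * b + b / (1 - a))" .
  have **: "(\<Phi> ^^ Suc n) f s \<le> a * (a ^ n * f s + b / (1 - a)) + b"
  proof -
    have "(\<Phi> ^^ Suc n) f s = (\<Phi> ^^ n) (\<Phi> f) s"
      by (simp add: funpow_swap1)
    also have "\<dots> \<le> a * (\<Phi> ^^ n) f s + b"
      by (rule markov_op_le_affine1[OF markov_op_funpow[OF assms(1)] assms(2) Suc.prems])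
    also have "\<dots> \<le> a * (a ^ n * f s + b / (1 - a)) + b"
      using Suc.IH[OF Suc.prems] assms(3) by (intro add_right_mono mult_left_mono) auto
    finally show ?thesis .
  qed
  have "a * (b / (1 - a)) + b = b / (1 - a)" using assms(4) by (simp add: field_simps)
  with ** show ?case by (simp add: algebra_simps)
qed (use assms in simp)

lemma markov_op_geometric:
  assumes "markov_op I \<Phi>" "\<And>s. I s \<Longrightarrow> \<Phi> f s \<le> a * f s" "0 \<le> a" "I s"
  shows "(\<Phi> ^^ n) f s \<le> a ^ n * f s"
proof (induction n)
  case (Suc n)
  have "(\<Phi> ^^ Suc n) f s = (\<Phi> ^^ n) (\<Phi> f) s"
    by (simp add: funpow_swap1)
  also have "\<dots> \<le> a * (\<Phi> ^^ n) f s"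
    using markov_op_le_affine1[OF markov_op_funpow[OF assms(1)], of "\<Phi> f" a f 0] assms(2,4) by simp
  also have "\<dots> \<le> a * (a ^ n * f s)" using Suc assms(3) by (rule mult_left_mono)
  finally show ?case by simp
qed simp

lemma rbb_step_configs:
  assumes "\<eta> \<in> rbb_configs L N" "u \<in> set_pmf (dest_law L)"
  shows "rbb_step L u \<eta> \<in> rbb_configs L N"
proof -
  have "(\<Sum>x=1..L. \<Sum>y=1..L. of_bool (\<eta> y > 0) * of_bool (u y = x)) =
        (\<Sum>y=1..L. \<Sum>x=1..L. of_bool (\<eta> y > 0) * of_bool (u y = x) :: nat)"
    by (rule sum.swap)
  also have "\<dots> = (\<Sum>y=1..L. of_bool (\<eta> y > 0))"
    using dest_law_range[OF assms(2)]
    by (intro sum.cong refl) (auto simp: of_bool_def sum.delta' simp flip: sum_distrib_left)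
  finally have *: "(\<Sum>x=1..L. \<Sum>y=1..L. of_bool (\<eta> y > 0) * of_bool (u y = x)) =
      (\<Sum>y=1..L. of_bool (\<eta> y > 0) :: nat)" .
  have "(\<Sum>x=1..L. rbb_step L u \<eta> x) =
      (\<Sum>x=1..L. \<eta> x - of_bool (\<eta> x > 0)) + (\<Sum>y=1..L. of_bool (\<eta> y > 0))"
    unfolding *[symmetric] sum.distrib[symmetric]
    by (rule sum.cong) (auto simp: rbb_step_def)
  also have "\<dots> = (\<Sum>x=1..L. \<eta> x)"
    unfolding sum.distrib[symmetric] by (rule sum.cong) auto
  finally show ?thesis using assms(1) by (auto simp: rbb_configs_def rbb_step_def)
qed

abbreviation rbb_op :: "nat \<Rightarrow> ((nat \<Rightarrow> nat) \<Rightarrow> real) \<Rightarrow> (nat \<Rightarrow> nat) \<Rightarrow> real" where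
  "rbb_op L \<equiv> step_op L (rbb_step L)"

lemma markov_op_rbb: "markov_op (\<lambda>\<eta>. \<eta> \<in> rbb_configs L N) (rbb_op L)"
  by (rule markov_op_step) (rule rbb_step_configs)

lemma finite_rbb_law: "finite (set_pmf (rbb_law L \<eta> t))"
proof -
  have "finite (set_pmf (Pi_pmf ({1..t} \<times> {1..L}) 0 (\<lambda>_. pmf_of_set {1..L})))"
  proof (cases "L = 0")
    case False
    show ?thesis
      by (rule finite_subset[OF set_Pi_pmf_subset']) (use False in \<open>auto intro!: finite_PiE_dflt\<close>)
  qed simp
  then show ?thesis by (simp add: rbb_law_def)
qed

lemma rbb_law_Suc:
  "rbb_law L \<eta> (Suc t) = bind_pmf (rbb_law L \<eta> t) (\<lambda>\<eta>'. map_pmf (\<lambda>u. rbb_step L u \<eta>') (dest_law L))"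
proof -
  define A where "A = {1..t} \<times> {1..L}"
  define B where "B = {Suc t} \<times> {1..L}"
  have AB: "{1..Suc t} \<times> {1..L} = A \<union> B" "A \<inter> B = {}" "finite A" "finite B"
    by (auto simp: A_def B_def)
  let ?D = "\<lambda>_::nat\<times>nat. pmf_of_set {1..L}"
  have path: "rbb_path L (\<lambda>x. if x \<in> A then f x else g x) \<eta> (Suc t) =
      rbb_step L (\<lambda>y. g (Suc t, y)) (rbb_path L f \<eta> t)" for f g
  proof -
    have "rbb_path L (\<lambda>x. if x \<in> A then f x else g x) \<eta> t = rbb_path L f \<eta> t"
      by (rule rbb_path_cong) (auto simp: A_def)
    then show ?thesis by (simp add: A_def)
  qed
  have B: "dest_law L = map_pmf (\<lambda>g. g \<circ> Pair (Suc t)) (Pi_pmf B 0 ?D)"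
    unfolding dest_law_def
    by (rule Pi_pmf_bij_betw) (auto simp: B_def bij_betw_def inj_on_def)
  have "rbb_law L \<eta> (Suc t) = map_pmf (\<lambda>(f, g). rbb_step L (g \<circ> Pair (Suc t)) (rbb_path L f \<eta> t))
      (pair_pmf (Pi_pmf A 0 ?D) (Pi_pmf B 0 ?D))"
    unfolding rbb_law_def AB(1) by (subst Pi_pmf_union[OF AB(3,4,2)])
      (simp add: pmf.map_comp o_def case_prod_beta' path del: rbb_path.simps)
  also have "\<dots> = bind_pmf (rbb_law L \<eta> t) (\<lambda>\<eta>'. map_pmf (\<lambda>u. rbb_step L u \<eta>') (dest_law L))"
    unfolding B rbb_law_def A_def
    by (simp add: pair_pmf_def map_pmf_def bind_assoc_pmf bind_return_pmf o_def)
  finally show ?thesis .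
qed

lemma expectation_bind_finite:
  assumes "finite (set_pmf p)" "\<And>x. finite (set_pmf (q x))"
  shows "measure_pmf.expectation (bind_pmf p q) f =
         measure_pmf.expectation p (\<lambda>x. measure_pmf.expectation (q x) (f :: _ \<Rightarrow> real))"
  using pmf_expectation_bind[OF assms(1), of q p f] assms
  by (subst integral_measure_pmf[OF assms(1)]) auto

text \<open>
  The law is defined through a whole array of destinations; its last row is independent of the earlier
  ones, which is the Markov property.
\<close>

lemma expectation_rbb_law:
  "measure_pmf.expectation (rbb_law L \<eta> t) f = (rbb_op L ^^ t) f \<eta>"
proof (induction t arbitrary: f)
  case 0
  show ?case by (simp add: rbb_law_def)
next
  case (Suc t)
  have "measure_pmf.expectation (rbb_law L \<eta> (Suc t)) f =
      measure_pmf.expectation (rbb_law L \<eta> t) (rbb_op L f)"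
    unfolding rbb_law_Suc step_op_def
    by (subst expectation_bind_finite) (auto simp: finite_rbb_law finite_dest_law)
  then show ?case by (simp add: Suc funpow_swap1)
qed

section \<open>Second-class particles\<close>

definition add_ball :: "(nat \<Rightarrow> nat) \<Rightarrow> nat \<Rightarrow> nat \<Rightarrow> nat" where
  "add_ball \<xi> x = \<xi>(x := Suc (\<xi> x))"

text \<open>
  A state \<open>(\<xi>, x, y)\<close> stands for the two configurations \<open>\<xi> + \<delta>\<^sub>x\<close> and \<open>\<xi> + \<delta>\<^sub>y\<close>. The extra ball is
  always served last at its site, so it only moves when \<open>\<xi>\<close> has no ball there. If both extra balls
  move in the same step they are sent to the same destination; from then on they stay together,
  because two extra balls at one site are served simultaneously.
\<close>

definition pair_step ::
    "nat \<Rightarrow> (nat \<Rightarrow> nat) \<Rightarrow> (nat \<Rightarrow> nat) \<times> nat \<times> nat \<Rightarrow> (nat \<Rightarrow> nat) \<times> nat \<times> nat" where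
  "pair_step L u s = (case s of (\<xi>, x, y) \<Rightarrow>
     (rbb_step L u \<xi>,
      if \<xi> x = 0 then u x else x,
      if \<xi> y = 0 then (if \<xi> x = 0 then u x else u y) else y))"

definition pair_state :: "nat \<Rightarrow> nat \<Rightarrow> (nat \<Rightarrow> nat) \<times> nat \<times> nat \<Rightarrow> bool" where
  "pair_state L N s \<longleftrightarrow> (case s of (\<xi>, x, y) \<Rightarrow> \<xi> \<in> rbb_configs L N \<and> x \<in> {1..L} \<and> y \<in> {1..L})"

abbreviation pair_op where
  "pair_op L \<equiv> step_op L (pair_step L)"

lemma pair_step_state:
  assumes "u \<in> set_pmf (dest_law L)" "pair_state L N s"
  shows "pair_state L N (pair_step L u s)"
  using assms rbb_step_configs[of _ L N u] dest_law_range[of u L]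
  unfolding pair_state_def pair_step_def by (auto split: prod.splits)

lemma markov_op_pair: "markov_op (pair_state L N) (pair_op L)"
  by (rule markov_op_step) (rule pair_step_state)

lemma rbb_step_add_ball:
  assumes "x \<in> {1..L}" "u x \<in> {1..L}"
  shows "rbb_step L u (add_ball \<xi> x) = add_ball (rbb_step L u \<xi>) (if \<xi> x = 0 then u x else x)"
proof
  fix z
  have *: "(\<Sum>y=1..L. of_bool (add_ball \<xi> x y > 0) * of_bool (u y = z)) =
      (\<Sum>y=1..L. of_bool (\<xi> y > 0) * of_bool (u y = z)) + (of_bool (\<xi> x = 0 \<and> u x = z) :: nat)"
  proof -
    have "(\<Sum>y=1..L. of_bool (add_ball \<xi> x y > 0) * of_bool (u y = z)) =
        (\<Sum>y=1..L. of_bool (\<xi> y > 0) * of_bool (u y = z) +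
           (if y = x then of_bool (\<xi> x = 0 \<and> u x = z) else (0::nat)))"
      by (rule sum.cong) (auto simp: add_ball_def)
    then show ?thesis using assms by (simp add: sum.distrib)
  qed
  show "rbb_step L u (add_ball \<xi> x) z = add_ball (rbb_step L u \<xi>) (if \<xi> x = 0 then u x else x) z"
    using assms unfolding rbb_step_def * by (auto simp: add_ball_def)
qed

lemma expectation_dest_law_transpose:
  assumes "x \<in> {1..L}" "y \<in> {1..L}"
  shows "measure_pmf.expectation (dest_law L) (\<lambda>u. f (u \<circ> Transposition.transpose x y) :: real) =
         measure_pmf.expectation (dest_law L) f"
proof -
  have "dest_law L = map_pmf (\<lambda>u. u \<circ> Transposition.transpose x y) (dest_law L)"
    unfolding dest_law_def
  proof (rule Pi_pmf_bij_betw)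
    show "bij_betw (Transposition.transpose x y) {1..L} {1..L}"
      using assms by (simp add: bij_betw_transpose_iff)
    show "Transposition.transpose x y z \<notin> {1..L}" if "z \<notin> {1..L}" for z
      using assms that by (auto simp: transpose_def)
  qed simp
  then have "measure_pmf.expectation (dest_law L) f =
      measure_pmf.expectation (map_pmf (\<lambda>u. u \<circ> Transposition.transpose x y) (dest_law L)) f"
    by simp
  then show ?thesis by simp
qed

lemma rbb_step_transpose:
  assumes "\<xi> x = 0" "\<xi> y = 0"
  shows "rbb_step L (u \<circ> Transposition.transpose x y) \<xi> = rbb_step L u \<xi>"
proof -
  have *: "of_bool (\<xi> w > 0) * of_bool ((u \<circ> Transposition.transpose x y) w = z) =
      (of_bool (\<xi> w > 0) * of_bool (u w = z) :: nat)" for w z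
    using assms by (cases "w = x"; cases "w = y") auto
  show ?thesis unfolding rbb_step_def * ..
qed

lemma pair_op_first:
  assumes "pair_state L N (\<xi>, x, y)"
  shows "(pair_op L ^^ n) (\<lambda>(\<xi>, x, y). f (add_ball \<xi> x)) (\<xi>, x, y) = (rbb_op L ^^ n) f (add_ball \<xi> x)"
  using assms
proof (induction n arbitrary: \<xi> x y)
  case (Suc n)
  have "(pair_op L ^^ n) (\<lambda>(\<xi>, x, y). f (add_ball \<xi> x)) (pair_step L u (\<xi>, x, y)) =
      (rbb_op L ^^ n) f (rbb_step L u (add_ball \<xi> x))" if u: "u \<in> set_pmf (dest_law L)" for u
  proof -
    have x: "x \<in> {1..L}" using Suc.prems by (simp add: pair_state_def)
    obtain y' where y': "pair_step L u (\<xi>, x, y) =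
        (rbb_step L u \<xi>, if \<xi> x = 0 then u x else x, y')"
      by (simp add: pair_step_def)
    show ?thesis unfolding y'
      using Suc.IH pair_step_state[OF u Suc.prems] rbb_step_add_ball[where u = u, OF x dest_law_range[OF u x]]
      unfolding y' by simp
  qed
  then show ?case by (auto intro!: step_op_cong)
qed simp

text \<open>
  The coupling is only correct in law for the second configuration: when both extra balls move it is
  driven by the destinations with \<open>x\<close> and \<open>y\<close> exchanged.
\<close>

lemma pair_op_second:
  assumes "pair_state L N (\<xi>, x, y)"
  shows "(pair_op L ^^ n) (\<lambda>(\<xi>, x, y). f (add_ball \<xi> y)) (\<xi>, x, y) = (rbb_op L ^^ n) f (add_ball \<xi> y)"
  using assms
proof (induction n arbitrary: \<xi> x y)
  case (Suc n)
  have xy: "x \<in> {1..L}" "y \<in> {1..L}" using Suc.prems by (auto simp: pair_state_def)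
  \<comment> \<open>The destinations that drive the second configuration.\<close>
  define \<sigma> :: "(nat \<Rightarrow> nat) \<Rightarrow> nat \<Rightarrow> nat" where
    "\<sigma> = (\<lambda>u. if \<xi> x = 0 \<and> \<xi> y = 0 then u \<circ> Transposition.transpose x y else u)"
  have "(pair_op L ^^ n) (\<lambda>(\<xi>, x, y). f (add_ball \<xi> y)) (pair_step L u (\<xi>, x, y)) =
      (rbb_op L ^^ n) f (rbb_step L (\<sigma> u) (add_ball \<xi> y))" if u: "u \<in> set_pmf (dest_law L)" for u
  proof -
    obtain x' where x': "pair_step L u (\<xi>, x, y) =
        (rbb_step L u \<xi>, x', if \<xi> y = 0 then (if \<xi> x = 0 then u x else u y) else y)"
      by (simp add: pair_step_def)
    have "\<sigma> u y \<in> {1..L}" using dest_law_range[OF u] xy by (auto simp: \<sigma>_def)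
    then have "rbb_step L (\<sigma> u) (add_ball \<xi> y) =
        add_ball (rbb_step L (\<sigma> u) \<xi>) (if \<xi> y = 0 then \<sigma> u y else y)"
      by (rule rbb_step_add_ball[OF xy(2)])
    also have "rbb_step L (\<sigma> u) \<xi> = rbb_step L u \<xi>"
      by (simp add: \<sigma>_def rbb_step_transpose)
    finally show ?thesis unfolding x'
      using Suc.IH pair_step_state[OF u Suc.prems] 
      unfolding x' by (simp add: \<sigma>_def)
  qed
  then have "(pair_op L ^^ Suc n) (\<lambda>(\<xi>, x, y). f (add_ball \<xi> y)) (\<xi>, x, y) =
      measure_pmf.expectation (dest_law L) (\<lambda>u. (rbb_op L ^^ n) f (rbb_step L (\<sigma> u) (add_ball \<xi> y)))"
    by (auto simp: step_op_def intro!: dest_expectation_cong)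
  also have "\<dots> = measure_pmf.expectation (dest_law L) (\<lambda>u. (rbb_op L ^^ n) f (rbb_step L u (add_ball \<xi> y)))"
    unfolding \<sigma>_def using expectation_dest_law_transpose[OF xy]
    by (cases "\<xi> x = 0 \<and> \<xi> y = 0") auto
  finally show ?case by (simp add: step_op_def[of L "rbb_step L" "(rbb_op L ^^ n) f"])
qed simp

lemma pair_op_background:
  "(pair_op L ^^ n) (\<lambda>s. f (fst s)) s = (rbb_op L ^^ n) f (fst s)"
proof (induction n arbitrary: s)
  case (Suc n)
  then show ?case
    by (auto intro!: step_op_cong simp: pair_step_def split: prod.splits)
qed simp

text \<open>
  The coupling inequality: the two expectations can only differ on trajectories on which the extra
  balls are still apart.
\<close>

lemma adjacent_diff_le:
  assumes "pair_state L N (\<xi>, x, y)" "\<And>\<eta>. 0 \<le> f \<eta>" "\<And>\<eta>. f \<eta> \<le> 1"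
  shows "\<bar>(rbb_op L ^^ t) f (add_ball \<xi> x) - (rbb_op L ^^ t) f (add_ball \<xi> y)\<bar>
           \<le> (pair_op L ^^ t) (\<lambda>(\<xi>, x, y). of_bool (x \<noteq> y)) (\<xi>, x, y)"
proof -
  let ?F = "\<lambda>(\<xi>, x, y). f (add_ball \<xi> x)" and ?G = "\<lambda>(\<xi>, x, y). f (add_ball \<xi> y)"
  let ?D = "\<lambda>(\<xi>::nat\<Rightarrow>nat, x::nat, y::nat). of_bool (x \<noteq> y) :: real"
  have le: "f \<eta> \<le> f \<eta>' + 1" for \<eta> \<eta>'
    using assms(2)[of \<eta>'] assms(3)[of \<eta>] by linarith
  note mk = markov_op_funpow[OF markov_op_pair[of L N], of t]
  have "(pair_op L ^^ t) ?F (\<xi>, x, y) \<le> 1 * (pair_op L ^^ t) ?G (\<xi>, x, y) + 1 * (pair_op L ^^ t) ?D (\<xi>, x, y) + 0"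
    by (rule markov_op_le_affine[OF mk _ assms(1)]) (auto simp: le)
  moreover have "(pair_op L ^^ t) ?G (\<xi>, x, y) \<le> 1 * (pair_op L ^^ t) ?F (\<xi>, x, y) + 1 * (pair_op L ^^ t) ?D (\<xi>, x, y) + 0"
    by (rule markov_op_le_affine[OF mk _ assms(1)]) (auto simp: le)
  ultimately show ?thesis
    unfolding pair_op_first[OF assms(1)] pair_op_second[OF assms(1)] by linarith
qed

section \<open>Exponential moments in one step\<close>

definition arrivals :: "nat \<Rightarrow> (nat \<Rightarrow> nat) \<Rightarrow> (nat \<Rightarrow> nat) \<Rightarrow> nat \<Rightarrow> nat" where
  "arrivals L u \<xi> z = (\<Sum>y=1..L. of_bool (\<xi> y > 0) * of_bool (u y = z))"

lemma rbb_step_arrivals: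
  "z \<in> {1..L} \<Longrightarrow> rbb_step L u \<xi> z = \<xi> z - of_bool (\<xi> z > 0) + arrivals L u \<xi> z"
  by (simp add: rbb_step_def arrivals_def)

lemma rbb_step_ge: "z \<in> {1..L} \<Longrightarrow> \<xi> z - 1 \<le> rbb_step L u \<xi> z"
  by (cases "\<xi> z") (simp_all add: rbb_step_arrivals)

lemma expectation_unif:
  "L \<ge> 1 \<Longrightarrow> measure_pmf.expectation (pmf_of_set {1..L}) f = (\<Sum>v=1..L. f v) / real L"
  by (subst integral_pmf_of_set) auto

lemma dest_expectation_prod:
  fixes F :: "nat \<Rightarrow> nat \<Rightarrow> real"
  assumes "L \<ge> 1" "\<And>y v. F y v \<ge> 0"
  shows "measure_pmf.expectation (dest_law L) (\<lambda>u. \<Prod>y=1..L. F y (u y)) =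
         (\<Prod>y=1..L. (\<Sum>v=1..L. F y v) / real L)"
  unfolding dest_law_def expectation_unif[OF assms(1), symmetric]
  by (rule expectation_prod_Pi_pmf)
     (use assms in \<open>auto intro!: integrable_measure_pmf_finite\<close>)

lemma dest_expectation_component:
  assumes "L \<ge> 1" "y \<in> {1..L}"
  shows "measure_pmf.expectation (dest_law L) (\<lambda>u. f (u y)) = (\<Sum>v=1..L. f v) / real L"
proof -
  have "map_pmf (\<lambda>u. u y) (dest_law L) = pmf_of_set {1..L}"
    using assms by (simp add: dest_law_def Pi_pmf_component)
  then have "measure_pmf.expectation (pmf_of_set {1..L}) f =
      measure_pmf.expectation (map_pmf (\<lambda>u. u y) (dest_law L)) f"
    by simp
  then show ?thesis using expectation_unif[OF assms(1)] by simp
qed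

lemma dest_prob_product:
  assumes "L \<ge> 1"
  shows "measure_pmf.expectation (dest_law L) (\<lambda>u. of_bool (\<forall>y\<in>{1..L}. u y \<in> F y)) =
         (\<Prod>y=1..L. real (card (F y \<inter> {1..L})) / real L)"
proof -
  have "of_bool (\<forall>y\<in>{1..L}. u y \<in> F y) = (\<Prod>y=1..L. of_bool (u y \<in> F y) :: real)" for u
    by (induction L) (auto simp: atLeastAtMostSuc_conv)
  moreover have "(\<Sum>v=1..L. of_bool (v \<in> F y)) = real (card (F y \<inter> {1..L}))" for y
    by (simp add: of_bool_def sum.If_cases Int_commute)
  ultimately show ?thesis
    using dest_expectation_prod[OF assms, of "\<lambda>y v. of_bool (v \<in> F y)"] by simp
qed

lemma exp_arrivals:
  "exp (l * real (arrivals L u \<xi> z)) = (\<Prod>y=1..L. if \<xi> y > 0 \<and> u y = z then exp l else 1)"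
proof -
  have "l * real (arrivals L u \<xi> z) = (\<Sum>y=1..L. if \<xi> y > 0 \<and> u y = z then l else 0)"
    unfolding arrivals_def of_nat_sum sum_distrib_left by (rule sum.cong) auto
  then show ?thesis by (simp add: exp_sum) (rule prod.cong, auto)
qed

lemma mgf_factor_le:
  assumes "L \<ge> 1" "l \<ge> 0"
  shows "(\<Sum>v=1..L. if b \<and> v = z then exp l else 1) / real L \<le> exp ((exp l - 1) / real L)"
proof -
  have "(\<Sum>v=1..L. if b \<and> v = z then exp l else 1) \<le>
      (\<Sum>v=1..L. 1 + (if v = z then exp l - 1 else 0))"
    using assms by (intro sum_mono) auto
  also have "\<dots> \<le> real L + (exp l - 1)" using assms by (simp add: sum.distrib)
  finally have "(\<Sum>v=1..L. if b \<and> v = z then exp l else 1) / real L \<le> 1 + (exp l - 1) / real L"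
    using assms by (simp add: field_simps)
  also have "\<dots> \<le> exp ((exp l - 1) / real L)" by (rule exp_ge_add_one_self)
  finally show ?thesis .
qed

text \<open>
  The number of arrivals is a sum of at most \<open>L\<close> independent Bernoulli variables of mean \<open>1 / L\<close>; its
  moment generating function is dominated by that of a Poisson variable of mean one.
\<close>

lemma mgf_arrivals:
  assumes "L \<ge> 1" "l \<ge> 0"
  shows "measure_pmf.expectation (dest_law L) (\<lambda>u. exp (l * real (arrivals L u \<xi> z)))
         \<le> exp (exp l - 1)"
proof -
  have "measure_pmf.expectation (dest_law L) (\<lambda>u. exp (l * real (arrivals L u \<xi> z))) =
      (\<Prod>y=1..L. (\<Sum>v=1..L. if \<xi> y > 0 \<and> v = z then exp l else 1) / real L)"
    unfolding exp_arrivals by (rule dest_expectation_prod[OF assms(1)]) auto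
  also have "\<dots> \<le> (\<Prod>y=1..L. exp ((exp l - 1) / real L))"
    by (intro prod_mono conjI mgf_factor_le assms divide_nonneg_nonneg sum_nonneg) auto
  also have "\<dots> = exp (exp l - 1)"
    using assms by (simp flip: exp_of_nat_mult)
  finally show ?thesis .
qed

text \<open>
  As \<open>w\<close> is empty, its destination is not used by the process and is independent of the arrivals.
\<close>

lemma mgf_arrivals_indicator:
  assumes "L \<ge> 1" "l \<ge> 0" "w \<in> {1..L}" "\<xi> w = 0" "v \<in> {1..L}"
  shows "measure_pmf.expectation (dest_law L) (\<lambda>u. of_bool (u w = v) * exp (l * real (arrivals L u \<xi> z)))
         \<le> exp (exp l - 1) / real L"
proof -
  define F :: "nat \<Rightarrow> nat \<Rightarrow> real" where
    "F = (\<lambda>y v'. (if \<xi> y > 0 \<and> v' = z then exp l else 1) * (if y = w then of_bool (v' = v) else 1))"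
  have "of_bool (u w = v) * exp (l * real (arrivals L u \<xi> z)) = (\<Prod>y=1..L. F y (u y))" for u
    using assms(3) by (simp add: F_def prod.distrib exp_arrivals)
  then have "measure_pmf.expectation (dest_law L) (\<lambda>u. of_bool (u w = v) * exp (l * real (arrivals L u \<xi> z)))
      = (\<Prod>y=1..L. (\<Sum>v'=1..L. F y v') / real L)"
    using dest_expectation_prod[OF assms(1), of F] by (simp add: F_def)
  also have "\<dots> \<le> (\<Prod>y=1..L. exp ((exp l - 1) / real L) * (if y = w then 1 / real L else 1))"
  proof (rule prod_mono)
    fix y assume "y \<in> {1..L}"
    show "0 \<le> (\<Sum>v'=1..L. F y v') / real L \<and>
      (\<Sum>v'=1..L. F y v') / real L \<le> exp ((exp l - 1) / real L) * (if y = w then 1 / real L else 1)"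
    proof (cases "y = w")
      case True
      have "(\<Sum>v'=1..L. F y v') = 1" using assms(4,5) True by (simp add: F_def of_bool_def)
      moreover have "1 * (1 / real L) \<le> exp ((exp l - 1) / real L) * (1 / real L)"
        using assms by (intro mult_right_mono) auto
      ultimately show ?thesis using True assms by simp
    next
      case False
      then show ?thesis using mgf_factor_le[OF assms(1,2), of "\<xi> y > 0" z]
        by (auto simp: F_def intro!: divide_nonneg_nonneg sum_nonneg)
    qed
  qed
  also have "\<dots> = exp (exp l - 1) / real L"
    using assms by (simp add: prod.distrib flip: exp_of_nat_mult)
  finally show ?thesis .
qed

lemma exp_rbb_step_le:
  assumes "z \<in> {1..L}" "l \<ge> 0"
  shows "exp (l * real (rbb_step L u \<xi> z)) \<le> exp (l * real (\<xi> z)) * exp (l * real (arrivals L u \<xi> z))"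
proof -
  have "real (rbb_step L u \<xi> z) \<le> real (\<xi> z) + real (arrivals L u \<xi> z)"
    by (simp add: rbb_step_arrivals[OF assms(1)])
  from mult_left_mono[OF this assms(2)] show ?thesis
    by (simp add: distrib_left flip: exp_add)
qed

lemma rbb_op_exp_le:
  assumes "z \<in> {1..L}" "l \<ge> 0"
  shows "rbb_op L (\<lambda>\<xi>. exp (l * real (\<xi> z))) \<xi> \<le> exp (exp l - 1) * exp (l * real (\<xi> z))"
proof -
  have "rbb_op L (\<lambda>\<xi>. exp (l * real (\<xi> z))) \<xi> \<le>
      measure_pmf.expectation (dest_law L) (\<lambda>u. exp (l * real (\<xi> z)) * exp (l * real (arrivals L u \<xi> z)))"
    unfolding step_op_def by (rule dest_expectation_mono) (rule exp_rbb_step_le[OF assms])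
  also have "\<dots> \<le> exp (l * real (\<xi> z)) * exp (exp l - 1)"
    using mgf_arrivals[of L l \<xi> z] assms by simp
  finally show ?thesis by (simp add: mult.commute)
qed

lemma rbb_op_pow_exp_le:
  assumes "z \<in> {1..L}" "l \<ge> 0" "\<xi> \<in> rbb_configs L N"
  shows "(rbb_op L ^^ n) (\<lambda>\<xi>. exp (l * real (\<xi> z))) \<xi> \<le> exp (exp l - 1) ^ n * exp (l * real (\<xi> z))"
  by (rule markov_op_geometric[OF markov_op_rbb[of L N]])
     (use assms rbb_op_exp_le[OF assms(1,2)] in auto)

text \<open>
  A site loses at most one ball per step. This controls the negative part of the increment in the
  remainder term of \<open>exp_scaled_le\<close>.
\<close>

lemma rbb_op_pow_exp_minus_le:
  assumes "z \<in> {1..L}" "\<xi> \<in> rbb_configs L N"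
  shows "(rbb_op L ^^ n) (\<lambda>\<xi>. exp (- real (\<xi> z))) \<xi> \<le> exp 1 ^ n * exp (- real (\<xi> z))"
proof (rule markov_op_geometric[OF markov_op_rbb[of L N]])
  fix \<eta> assume "\<eta> \<in> rbb_configs L N"
  have "rbb_op L (\<lambda>\<xi>. exp (- real (\<xi> z))) \<eta> \<le> measure_pmf.expectation (dest_law L) (\<lambda>u. exp 1 * exp (- real (\<eta> z)))"
    unfolding step_op_def
  proof (rule dest_expectation_mono)
    fix u
    have "- real (rbb_step L u \<eta> z) \<le> 1 + - real (\<eta> z)"
      using rbb_step_ge[OF assms(1), of \<eta> u] by linarith
    then show "exp (- real (rbb_step L u \<eta> z)) \<le> exp 1 * exp (- real (\<eta> z))"
      by (simp flip: exp_add)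
  qed
  then show "rbb_op L (\<lambda>\<xi>. exp (- real (\<xi> z))) \<eta> \<le> exp 1 * exp (- real (\<eta> z))" by simp
qed (use assms in auto)

section \<open>Empty sites\<close>

text \<open>
  The probability that none of \<open>L\<close> balls hits a given pair of sites does not vanish as \<open>L\<close> grows.
\<close>

lemma one_minus_power_ge:
  assumes "L \<ge> 4"
  shows "(exp (-4) :: real) \<le> (1 - 2 / real L) ^ L"
proof -
  define x where "x = 2 / real L"
  have x: "0 \<le> x" "x \<le> 1/2" using assms by (auto simp: x_def field_simps)
  have "- x - 2 * x\<^sup>2 \<ge> - 2 * x"
  proof -
    have "x * x \<le> x * (1/2)" by (rule mult_left_mono) (use x in auto)
    then show ?thesis by (simp add: power2_eq_square)
  qed
  with ln_one_minus_pos_lower_bound[OF x] have "- 2 * x \<le> ln (1 - x)" by linarith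
  then have "exp (- 2 * x) \<le> 1 - x" using x by (subst (asm) ln_ge_iff) auto
  then have "exp (- 2 * x) ^ L \<le> (1 - x) ^ L" by (rule power_mono) simp
  moreover have "exp (- 2 * x) ^ L = exp (-4)"
    using assms by (simp add: x_def flip: exp_of_nat_mult)
  ultimately show ?thesis by (simp add: x_def)
qed

lemma fraction_avoid_ge:
  assumes "L \<ge> 1"
  shows "1 - 2 / real L \<le> real (card (- {p, q} \<inter> {1..L})) / real L"
proof -
  have "card {1..L} - card {p, q} \<le> card ({1..L} - {p, q})" by (rule diff_card_le_card_Diff) simp
  moreover have "card {p, q} \<le> 2" by (simp add: card_insert_if)
  moreover have "{1..L} - {p, q} = - {p, q} \<inter> {1..L}" by blast
  ultimately have "real L - 2 \<le> real (card (- {p, q} \<inter> {1..L}))" by simp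
  from divide_right_mono[OF this, of "real L"] show ?thesis
    using assms by (simp add: diff_divide_distrib)
qed

lemma prob_avoid_ge:
  assumes "L \<ge> 4"
  shows "(exp (-4) :: real) \<le> measure_pmf.expectation (dest_law L) (\<lambda>u. of_bool (\<forall>y\<in>{1..L}. u y \<notin> {p, q}))"
proof -
  have "1 - 2 / real L \<le> real (card (- {p, q} \<inter> {1..L})) / real L"
    by (rule fraction_avoid_ge) (use assms in simp)
  then have "(1 - 2 / real L) ^ L \<le> (real (card (- {p, q} \<inter> {1..L})) / real L) ^ L"
    using assms by (intro power_mono) (auto simp: field_simps)
  moreover have "measure_pmf.expectation (dest_law L) (\<lambda>u. of_bool (\<forall>y\<in>{1..L}. u y \<in> - {p, q})) =
      (real (card (- {p, q} \<inter> {1..L})) / real L) ^ L"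
    using assms by (subst dest_prob_product) auto
  ultimately show ?thesis using one_minus_power_ge[OF assms] by simp
qed

lemma arrivals_eq_0: "\<forall>y\<in>{1..L}. u y \<noteq> z \<Longrightarrow> arrivals L u \<xi> z = 0"
  by (auto simp: arrivals_def)

lemma rbb_op_empty_step:
  assumes "L \<ge> 4" "z \<in> {1..L}"
  shows "exp (-4) * of_bool (\<xi> z \<le> Suc j) \<le> rbb_op L (\<lambda>\<xi>. of_bool (\<xi> z \<le> j)) \<xi>"
proof (cases "\<xi> z \<le> Suc j")
  case True
  have "(exp (-4) :: real) \<le> measure_pmf.expectation (dest_law L) (\<lambda>u. of_bool (\<forall>y\<in>{1..L}. u y \<notin> {z, z}))"
    by (rule prob_avoid_ge[OF assms(1)])
  also have "\<dots> \<le> rbb_op L (\<lambda>\<xi>. of_bool (\<xi> z \<le> j)) \<xi>"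
    unfolding step_op_def
    by (rule dest_expectation_mono) (use True arrivals_eq_0 assms in \<open>auto simp: rbb_step_arrivals\<close>)
  finally show ?thesis using True by simp
next
  case False
  then show ?thesis by (auto simp: step_op_def intro!: integral_nonneg_AE)
qed

text \<open>
  A site with at most \<open>n\<close> balls is empty after \<open>n\<close> steps if no ball arrives in the meantime.
\<close>

lemma rbb_op_pow_empty_ge:
  assumes "L \<ge> 4" "z \<in> {1..L}" "\<xi> \<in> rbb_configs L N"
  shows "(exp (-4) :: real) ^ n * of_bool (\<xi> z \<le> n) \<le> (rbb_op L ^^ n) (\<lambda>\<xi>. of_bool (\<xi> z = 0)) \<xi>"
  using assms(3)
proof (induction n arbitrary: \<xi>)
  case (Suc n)
  have "(exp (-4) :: real) ^ Suc n * of_bool (\<xi> z \<le> Suc n) = exp (-4) ^ n * (exp (-4) * of_bool (\<xi> z \<le> Suc n))"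
    by simp
  also have "\<dots> \<le> exp (-4) ^ n * rbb_op L (\<lambda>\<xi>. of_bool (\<xi> z \<le> n)) \<xi>"
    by (intro mult_left_mono rbb_op_empty_step assms) auto
  also have "\<dots> \<le> (rbb_op L ^^ Suc n) (\<lambda>\<xi>. of_bool (\<xi> z = 0)) \<xi>"
    using markov_op_ge_affine1[OF markov_op_rbb[of L N], of "exp (-4) ^ n" "\<lambda>\<xi>. of_bool (\<xi> z \<le> n)" 0
        "(rbb_op L ^^ n) (\<lambda>\<xi>. of_bool (\<xi> z = 0))" \<xi>] Suc by simp
  finally show ?case .
qed simp

definition empty_fraction :: "nat \<Rightarrow> (nat \<Rightarrow> nat) \<Rightarrow> real" where
  "empty_fraction L \<xi> = (\<Sum>z=1..L. of_bool (\<xi> z = 0)) / real L"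

text \<open>
  Markov's inequality for the occupation of a uniformly chosen site, whose mean is at most \<open>r\<close>.
\<close>

lemma card_small_sites_ge:
  assumes "\<xi> \<in> rbb_configs L N" "real N \<le> r * real L" "2 * r \<le> real K"
  shows "real L / 2 \<le> (\<Sum>z=1..L. of_bool (\<xi> z \<le> K))"
proof (cases "L = 0")
  case False
  have "real K * (\<Sum>z=1..L. of_bool (\<not> \<xi> z \<le> K)) \<le> (\<Sum>z=1..L. real (\<xi> z))"
    unfolding sum_distrib_left by (rule sum_mono) auto
  also have "\<dots> \<le> r * real L" using assms(1,2) by (simp add: rbb_configs_def flip: of_nat_sum)
  also have "\<dots> \<le> real K / 2 * real L" using assms(3) by (intro mult_right_mono) auto
  finally have "real K * (\<Sum>z=1..L. of_bool (\<not> \<xi> z \<le> K)) \<le> real K * (real L / 2)" by simp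
  moreover have "(\<Sum>z=1..L. of_bool (\<not> \<xi> z \<le> K)) = real L - (\<Sum>z=1..L. of_bool (\<xi> z \<le> K))"
    by (simp add: of_bool_not_iff sum_subtractf)
  moreover have "K = 0 \<Longrightarrow> (\<Sum>z=1..L. real (\<xi> z)) \<le> 0"
    using \<open>(\<Sum>z=1..L. real (\<xi> z)) \<le> r * real L\<close> \<open>r * real L \<le> real K / 2 * real L\<close> by simp
  moreover have "(\<Sum>z=1..L. of_bool (\<xi> z \<le> K)) = real L" if "(\<Sum>z=1..L. real (\<xi> z)) \<le> 0"
  proof -
    have "(\<Sum>z=1..L. real (\<xi> z)) = 0" using that by (intro antisym sum_nonneg) auto
    then have "\<forall>z\<in>{1..L}. \<xi> z = 0" by (subst (asm) sum_nonneg_eq_0_iff) auto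
    then show ?thesis by simp
  qed
  ultimately show ?thesis by (cases "K = 0") (auto simp: mult_le_cancel_left_pos)
qed simp

text \<open>
  This is where the density enters. Whatever the configuration is, half of the sites have at most \<open>K\<close>
  balls by conservation of the number of balls, and each of these sites is empty \<open>K\<close> steps later with
  a probability that does not depend on \<open>L\<close>.
\<close>

lemma rbb_op_pow_empty_fraction_ge:
  assumes "L \<ge> 4" "\<xi> \<in> rbb_configs L N" "real N \<le> r * real L" "2 * r \<le> real K"
  shows "exp (-4) ^ K / 2 \<le> (rbb_op L ^^ K) (empty_fraction L) \<xi>"
proof -
  note mk = markov_op_funpow[OF markov_op_rbb[of L N], of K]
  have "empty_fraction L = (\<lambda>\<xi>. (1 / real L) * (\<Sum>z=1..L. of_bool (\<xi> z = 0)) + 0 * (0::real) + 0)"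
    by (simp add: empty_fraction_def fun_eq_iff)
  then have eq: "(rbb_op L ^^ K) (empty_fraction L) \<xi> =
      (1 / real L) * (\<Sum>z=1..L. (rbb_op L ^^ K) (\<lambda>\<xi>. of_bool (\<xi> z = 0)) \<xi>)"
    by (simp only: markov_op_affine[OF mk] markov_op_sum[OF mk] finite_atLeastAtMost)
  have "exp (-4) ^ K / 2 = (1 / real L) * (exp (-4) ^ K * (real L / 2))" using assms(1) by simp
  also have "\<dots> \<le> (1 / real L) * (exp (-4) ^ K * (\<Sum>z=1..L. of_bool (\<xi> z \<le> K)))"
    by (intro mult_left_mono card_small_sites_ge[OF assms(2-)]) auto
  also have "\<dots> \<le> (1 / real L) * (\<Sum>z=1..L. (rbb_op L ^^ K) (\<lambda>\<xi>. of_bool (\<xi> z = 0)) \<xi>)"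
    unfolding sum_distrib_left[of "exp (-4) ^ K"]
    by (intro mult_left_mono sum_mono rbb_op_pow_empty_ge[OF assms(1) _ assms(2)]) auto
  finally show ?thesis by (simp add: eq)
qed

section \<open>Drift of a single site\<close>

text \<open>
  Every site receives on average as many balls as the fraction of nonempty sites, and the nonempty
  ones lose one ball; so a nonempty site shrinks in mean exactly by the fraction of empty sites.
\<close>

lemma rbb_op_occupancy:
  assumes "z \<in> {1..L}"
  shows "rbb_op L (\<lambda>\<xi>. real (\<xi> z)) \<xi> = real (\<xi> z) + of_bool (\<xi> z = 0) - empty_fraction L \<xi>"
proof -
  have L: "L \<ge> 1" using assms by simp
  have "rbb_op L (\<lambda>\<xi>. real (\<xi> z)) \<xi> =
      measure_pmf.expectation (dest_law L) (\<lambda>u. real (\<xi> z - of_bool (\<xi> z > 0)) +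
         (\<Sum>y=1..L. of_bool (\<xi> y > 0) * of_bool (u y = z)))"
    unfolding step_op_def rbb_step_arrivals[OF assms] arrivals_def by simp
  also have "\<dots> = real (\<xi> z - of_bool (\<xi> z > 0)) +
      (\<Sum>y=1..L. of_bool (\<xi> y > 0) * measure_pmf.expectation (dest_law L) (\<lambda>u. of_bool (u y = z)))"
    by (simp del: sum_of_bool_eq sum_mult_of_bool_eq sum_of_bool_mult_eq)
  also have "(\<Sum>y=1..L. of_bool (\<xi> y > 0) * measure_pmf.expectation (dest_law L) (\<lambda>u. of_bool (u y = z)))
      = (\<Sum>y=1..L. of_bool (\<xi> y > 0) * (1 / real L))"
    using dest_expectation_component[OF L, of _ "\<lambda>v. of_bool (v = z)"] assms
    by (intro sum.cong refl) (simp add: of_bool_def)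
  also have "\<dots> = (\<Sum>y=1..L. 1 - of_bool (\<xi> y = 0)) / real L"
    unfolding sum_divide_distrib by (rule sum.cong) auto
  also have "\<dots> = 1 - empty_fraction L \<xi>"
    using L by (simp add: sum_subtractf empty_fraction_def diff_divide_distrib)
  finally show ?thesis by (cases "\<xi> z = 0") auto
qed

lemma empty_fraction_nonneg: "0 \<le> empty_fraction L \<xi>"
  by (auto simp: empty_fraction_def intro!: divide_nonneg_nonneg sum_nonneg)

lemma rbb_op_pow_not_empty:
  assumes "z \<in> {1..L}" "\<xi> z > n"
  shows "(rbb_op L ^^ n) (\<lambda>\<xi>. of_bool (\<xi> z = 0)) \<xi> = 0"
  using assms(2)
proof (induction n arbitrary: \<xi>)
  case (Suc n)
  have "(rbb_op L ^^ n) (\<lambda>\<xi>. of_bool (\<xi> z = 0)) (rbb_step L u \<xi>) = 0" for u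
    by (rule Suc.IH) (use rbb_step_ge[OF assms(1), of \<xi> u] Suc.prems in linarith)
  then show ?case
    by (simp add: step_op_def[of L "rbb_step L" "(rbb_op L ^^ n) (\<lambda>\<xi>. of_bool (\<xi> z = 0))"])
qed simp

lemma rbb_op_pow_occupancy_le:
  assumes "z \<in> {1..L}" "\<xi> \<in> rbb_configs L N" "\<xi> z \<ge> n"
  shows "(rbb_op L ^^ n) (\<lambda>\<xi>. real (\<xi> z)) \<xi> \<le> real (\<xi> z)"
  using assms(3)
proof (induction n)
  case (Suc n)
  have "(rbb_op L ^^ Suc n) (\<lambda>\<xi>. real (\<xi> z)) \<xi> = (rbb_op L ^^ n) (rbb_op L (\<lambda>\<xi>. real (\<xi> z))) \<xi>"
    by (simp add: funpow_swap1)
  also have "\<dots> \<le> 1 * (rbb_op L ^^ n) (\<lambda>\<xi>. real (\<xi> z)) \<xi> + 1 * (rbb_op L ^^ n) (\<lambda>\<xi>. of_bool (\<xi> z = 0)) \<xi> + 0"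
    by (rule markov_op_le_affine[OF markov_op_funpow[OF markov_op_rbb[of L N]]])
       (use empty_fraction_nonneg assms(2) in \<open>simp_all add: rbb_op_occupancy[OF assms(1)]\<close>)
  also have "\<dots> \<le> real (\<xi> z)"
    using Suc rbb_op_pow_not_empty[OF assms(1), of n \<xi>] by simp
  finally show ?case .
qed simp

text \<open>
  A site with more than \<open>K\<close> balls stays nonempty for the next \<open>K\<close> steps. Its mean occupation does not
  increase during these steps, and in the following one it decreases by the mean fraction of empty sites.
\<close>

lemma rbb_op_pow_occupancy_drift:
  assumes "L \<ge> 4" "z \<in> {1..L}" "\<xi> \<in> rbb_configs L N" "real N \<le> r * real L" "2 * r \<le> real K" "\<xi> z \<ge> Suc K"
  shows "(rbb_op L ^^ Suc K) (\<lambda>\<xi>. real (\<xi> z)) \<xi> \<le> real (\<xi> z) - exp (-4) ^ K / 2"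
proof -
  note mk = markov_op_funpow[OF markov_op_rbb[of L N], of K]
  have "(rbb_op L ^^ Suc K) (\<lambda>\<xi>. real (\<xi> z)) \<xi> = (rbb_op L ^^ K) (rbb_op L (\<lambda>\<xi>. real (\<xi> z))) \<xi>"
    by (simp add: funpow_swap1)
  also have "\<dots> = (rbb_op L ^^ K) (\<lambda>\<xi>. 1 * (1 * real (\<xi> z) + 1 * of_bool (\<xi> z = 0) + 0) + (-1) * empty_fraction L \<xi> + 0) \<xi>"
    by (rule arg_cong[where f = "\<lambda>f. (rbb_op L ^^ K) f \<xi>"]) (simp add: rbb_op_occupancy[OF assms(2)] fun_eq_iff)
  also have "\<dots> = (rbb_op L ^^ K) (\<lambda>\<xi>. real (\<xi> z)) \<xi> + (rbb_op L ^^ K) (\<lambda>\<xi>. of_bool (\<xi> z = 0)) \<xi> 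
      - (rbb_op L ^^ K) (empty_fraction L) \<xi>"
    by (simp only: markov_op_affine[OF mk]) simp
  also have "\<dots> \<le> real (\<xi> z) + 0 - exp (-4) ^ K / 2"
    using rbb_op_pow_occupancy_le[OF assms(2,3), of K] rbb_op_pow_not_empty[OF assms(2), of K \<xi>]
      rbb_op_pow_empty_fraction_ge[OF assms(1,3,4,5)] assms(6)
    by linarith
  finally show ?thesis by simp
qed

text \<open>
  Taylor's formula with a second-order remainder that is integrable under exponential moments; it
  turns a drift of the mean into a contraction of \<open>exp (l * x)\<close> for small \<open>l\<close>.
\<close>

lemma exp_scaled_le:
  fixes x l :: real
  assumes "0 \<le> l" "l \<le> 1/2"
  shows "exp (l * x) \<le> 1 + l * x + 4 * l\<^sup>2 * (exp x + exp (- x))"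
proof -
  obtain t where t: "\<bar>t\<bar> \<le> \<bar>l * x\<bar>" "exp (l * x) = (\<Sum>m<2. (l * x) ^ m / fact m) + exp t / fact 2 * (l * x) ^ 2"
    using Maclaurin_exp_le[of "l * x" 2] by blast
  have "\<bar>l * x\<bar> \<le> \<bar>x\<bar> / 2" using assms mult_right_mono[OF assms(2), of "\<bar>x\<bar>"] by (simp add: abs_mult)
  then have et: "exp t \<le> exp (\<bar>x\<bar> / 2)" using t(1) by auto
  have sq: "x\<^sup>2 \<le> 8 * exp (\<bar>x\<bar> / 2)"
  proof -
    have "1 + \<bar>x\<bar> / 2 + (\<bar>x\<bar> / 2)\<^sup>2 / 2 \<le> exp (\<bar>x\<bar> / 2)"
      by (rule exp_lower_Taylor_quadratic) simp
    then show ?thesis by (simp add: power_divide)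
  qed
  have "exp t * x\<^sup>2 \<le> exp (\<bar>x\<bar> / 2) * (8 * exp (\<bar>x\<bar> / 2))"
    by (rule mult_mono) (use et sq in auto)
  also have "\<dots> = 8 * exp \<bar>x\<bar>" by (simp flip: exp_add)
  also have "\<dots> \<le> 8 * (exp x + exp (- x))" by (simp add: abs_if)
  finally have "l\<^sup>2 * (exp t * x\<^sup>2) \<le> l\<^sup>2 * (8 * (exp x + exp (- x)))" by (rule mult_left_mono) simp
  then show ?thesis using t(2) by (simp add: numeral_2_eq_2 power_mult_distrib algebra_simps)
qed

text \<open>
  Only the mean of the fraction of empty sites is known to be bounded below, and it is correlated with
  the site itself. This does no harm: over a block of \<open>k\<close> steps the occupation changes by an increment
  with bounded exponential moments and negative mean, and for small \<open>l\<close> the first-order term dominates.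
\<close>

lemma exp_moment_block_drift:
  fixes r :: real
  assumes "r > 0"
  obtains k :: nat and l \<gamma> B :: real where "k \<ge> 1" "l > 0" "0 < \<gamma>" "\<gamma> < 1" "B \<ge> 0"
    "\<And>L N \<xi> z. L \<ge> 4 \<Longrightarrow> \<xi> \<in> rbb_configs L N \<Longrightarrow> real N \<le> r * real L \<Longrightarrow> z \<in> {1..L} \<Longrightarrow>
       (rbb_op L ^^ k) (\<lambda>\<xi>. exp (l * real (\<xi> z))) \<xi> \<le> \<gamma> * exp (l * real (\<xi> z)) + B"
proof -
  define K where "K = nat \<lceil>2 * r\<rceil>"
  have K: "2 * r \<le> real K" unfolding K_def by linarith
  define \<delta> :: real where "\<delta> = exp (-4) ^ K / 2"
  have \<delta>: "\<delta> > 0" "\<delta> \<le> 1" by (auto simp: \<delta>_def intro!: order_trans[OF power_le_one])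
  define C :: real where "C = exp (exp 1 - 1) ^ Suc K + exp 1 ^ Suc K"
  have "1 \<le> (exp 1 :: real) ^ Suc K" by (rule one_le_power) simp
  then have C: "C \<ge> 1" unfolding C_def by (intro add_increasing) auto
  \<comment> \<open>With this \<open>l\<close> the second-order term \<open>4 * l\<^sup>2 * C\<close> is half of the first-order gain \<open>l * \<delta>\<close>.\<close>
  define l where "l = \<delta> / (8 * C)"
  have l: "l > 0" "l \<le> 1/2" using \<delta> C by (auto simp: l_def field_simps)
  define \<gamma> where "\<gamma> = 1 - l * \<delta> / 2"
  have "l * \<delta> \<le> 1/2 * 1" by (rule mult_mono) (use l \<delta> in auto)
  then have \<gamma>: "0 < \<gamma>" "\<gamma> < 1" using l \<delta> by (auto simp: \<gamma>_def)
  define B where "B = exp (exp l - 1) ^ Suc K * exp (l * real (Suc K))"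
  show ?thesis
  proof (rule that[of "Suc K" l \<gamma> B])
    show "B \<ge> 0" by (simp add: B_def)
    fix L N \<xi> z
    assume A: "4 \<le> L" "\<xi> \<in> rbb_configs L N" "real N \<le> r * real L" "z \<in> {1..L}"
    note mk = markov_op_funpow[OF markov_op_rbb[of L N], of "Suc K"]
    let ?E = "\<lambda>f. (rbb_op L ^^ Suc K) f \<xi>"
    show "?E (\<lambda>\<xi>. exp (l * real (\<xi> z))) \<le> \<gamma> * exp (l * real (\<xi> z)) + B"
    proof (cases "\<xi> z \<ge> Suc K")
      case True
      define a where "a = real (\<xi> z)"
      define c where "c = exp (l * a)"
      have inv: "exp (-a) * (X * exp a) + exp a * (Y * exp (- a)) = X + Y" for X Y :: real
        by (simp add: exp_minus field_simps)
      have "?E (\<lambda>\<xi>. exp (l * real (\<xi> z))) \<le>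
          c * l * ?E (\<lambda>\<xi>. real (\<xi> z)) + c * (4 * l\<^sup>2) * ?E (\<lambda>\<xi>. exp (-a) * exp (1 * real (\<xi> z)) + exp a * exp (- real (\<xi> z)) + 0) + c * (1 - l * a)"
      proof (rule markov_op_le_affine[OF mk])
        show "\<xi> \<in> rbb_configs L N" by (rule A(2))
        fix \<zeta> :: "nat \<Rightarrow> nat"
        have "exp (l * real (\<zeta> z)) = c * exp (l * (real (\<zeta> z) - a))"
          by (simp add: c_def algebra_simps flip: exp_add)
        also have "\<dots> \<le> c * (1 + l * (real (\<zeta> z) - a) + 4 * l\<^sup>2 * (exp (real (\<zeta> z) - a) + exp (- (real (\<zeta> z) - a))))"
          by (intro mult_left_mono exp_scaled_le) (use l in \<open>auto simp: c_def\<close>)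
        also have "\<dots> = c * l * real (\<zeta> z) + c * (4 * l\<^sup>2) * (exp (-a) * exp (1 * real (\<zeta> z)) + exp a * exp (- real (\<zeta> z)) + 0) + c * (1 - l * a)"
          by (simp add: algebra_simps exp_diff exp_minus divide_inverse)
        finally show "exp (l * real (\<zeta> z)) \<le> \<dots>" .
      qed
      also have "?E (\<lambda>\<xi>. exp (-a) * exp (1 * real (\<xi> z)) + exp a * exp (- real (\<xi> z)) + 0) =
          exp (-a) * ?E (\<lambda>\<xi>. exp (1 * real (\<xi> z))) + exp a * ?E (\<lambda>\<xi>. exp (- real (\<xi> z)))"
        by (simp only: markov_op_affine[OF mk])
      also have "c * l * ?E (\<lambda>\<xi>. real (\<xi> z)) +
         c * (4 * l\<^sup>2) * (exp (-a) * ?E (\<lambda>\<xi>. exp (1 * real (\<xi> z))) + exp a * ?E (\<lambda>\<xi>. exp (- real (\<xi> z)))) + c * (1 - l * a)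
        \<le> c * l * (a - \<delta>) + c * (4 * l\<^sup>2) * (exp (-a) * (exp (exp 1 - 1) ^ Suc K * exp a) + exp a * (exp 1 ^ Suc K * exp (- a))) + c * (1 - l * a)"
        using rbb_op_pow_occupancy_drift[OF A(1,4,2,3) K True] rbb_op_pow_exp_le[OF A(4) _ A(2), of 1 "Suc K"]
          rbb_op_pow_exp_minus_le[OF A(4,2), of "Suc K"] l
        by (intro add_mono mult_left_mono) (auto simp: c_def a_def \<delta>_def simp del: funpow.simps)
      also have "\<dots> = c * (1 - l * \<delta> + 4 * l\<^sup>2 * C)"
        unfolding inv by (simp add: C_def algebra_simps)
      also have "4 * l\<^sup>2 * C = l * \<delta> / 2"
        using C by (simp add: l_def power2_eq_square field_simps)
      also have "c * (1 - l * \<delta> + l * \<delta> / 2) \<le> \<gamma> * c + B"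
        by (simp add: \<gamma>_def B_def algebra_simps)
      finally show ?thesis by (simp add: c_def a_def)
    next
      case False
      have "?E (\<lambda>\<xi>. exp (l * real (\<xi> z))) \<le> exp (exp l - 1) ^ Suc K * exp (l * real (\<xi> z))"
        by (rule rbb_op_pow_exp_le[OF A(4) _ A(2)]) (use l in simp)
      also have "\<dots> \<le> exp (exp l - 1) ^ Suc K * exp (l * real (Suc K))"
        using False l by (intro mult_left_mono) (auto intro!: mult_left_mono)
      also have "\<dots> \<le> \<gamma> * exp (l * real (\<xi> z)) + B" using \<gamma> by (simp add: B_def)
      finally show ?thesis .
    qed
  qed (use l \<gamma> in auto)
qed

section \<open>Drift of the pair\<close>

definition mean_exp :: "real \<Rightarrow> nat \<Rightarrow> (nat \<Rightarrow> nat) \<Rightarrow> real" where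
  "mean_exp l L \<xi> = (\<Sum>z=1..L. exp (l * real (\<xi> z))) / real L"

lemma mean_exp_nonneg: "0 \<le> mean_exp l L \<xi>"
  by (auto simp: mean_exp_def intro!: divide_nonneg_nonneg sum_nonneg)

lemma rbb_op_pow_mean_exp_le:
  assumes "\<And>z. z \<in> {1..L} \<Longrightarrow> (rbb_op L ^^ n) (\<lambda>\<xi>. exp (l * real (\<xi> z))) \<xi> \<le> a * exp (l * real (\<xi> z)) + b"
    "L \<ge> 1"
  shows "(rbb_op L ^^ n) (mean_exp l L) \<xi> \<le> a * mean_exp l L \<xi> + b"
proof -
  have mk: "markov_op (\<lambda>_. True) (rbb_op L ^^ n)"
    by (rule markov_op_funpow[OF markov_op_step]) simp
  have "mean_exp l L = (\<lambda>\<xi>. (1 / real L) * (\<Sum>z=1..L. exp (l * real (\<xi> z))) + 0 * (0::real) + 0)"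
    by (simp add: mean_exp_def fun_eq_iff)
  then have "(rbb_op L ^^ n) (mean_exp l L) \<xi> =
      (1 / real L) * (\<Sum>z=1..L. (rbb_op L ^^ n) (\<lambda>\<xi>. exp (l * real (\<xi> z))) \<xi>)"
    by (simp only: markov_op_affine[OF mk] markov_op_sum[OF mk] finite_atLeastAtMost)
  also have "\<dots> \<le> (1 / real L) * (\<Sum>z=1..L. a * exp (l * real (\<xi> z)) + b)"
    by (intro mult_left_mono sum_mono assms(1)) auto
  also have "\<dots> = a * mean_exp l L \<xi> + b"
    using assms(2) by (simp add: mean_exp_def sum.distrib sum_distrib_left[symmetric] field_simps)
  finally show ?thesis .
qed

text \<open>
  An extra ball that jumps lands on a uniformly chosen site that is independent of the new background
  configuration, so the exponential moment at its new position is an average over all sites.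
\<close>

lemma exp_jump_le:
  assumes "w \<in> {1..L}" "\<xi> w = 0" "l \<ge> 0"
  shows "measure_pmf.expectation (dest_law L) (\<lambda>u. exp (l * real (rbb_step L u \<xi> (u w))))
         \<le> exp (exp l - 1) * mean_exp l L \<xi>"
proof -
  have L: "L \<ge> 1" using assms by simp
  have "measure_pmf.expectation (dest_law L) (\<lambda>u. exp (l * real (rbb_step L u \<xi> (u w)))) \<le>
      measure_pmf.expectation (dest_law L) (\<lambda>u. \<Sum>z=1..L. exp (l * real (\<xi> z)) * (of_bool (u w = z) * exp (l * real (arrivals L u \<xi> z))))"
  proof (rule dest_expectation_mono)
    fix u assume u: "u \<in> set_pmf (dest_law L)"
    have uw: "u w \<in> {1..L}" by (rule dest_law_range[OF u assms(1)])
    have "exp (l * real (rbb_step L u \<xi> (u w))) \<le> exp (l * real (\<xi> (u w))) * exp (l * real (arrivals L u \<xi> (u w)))"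
      by (rule exp_rbb_step_le[OF uw assms(3)])
    also have "\<dots> = (\<Sum>z=1..L. if z = u w then exp (l * real (\<xi> z)) * exp (l * real (arrivals L u \<xi> z)) else 0)"
      using uw by simp
    also have "\<dots> = (\<Sum>z=1..L. exp (l * real (\<xi> z)) * (of_bool (u w = z) * exp (l * real (arrivals L u \<xi> z))))"
      by (rule sum.cong) auto
    finally show "exp (l * real (rbb_step L u \<xi> (u w))) \<le> \<dots>" .
  qed
  also have "\<dots> = (\<Sum>z=1..L. exp (l * real (\<xi> z)) * measure_pmf.expectation (dest_law L) (\<lambda>u. of_bool (u w = z) * exp (l * real (arrivals L u \<xi> z))))"
    by simp
  also have "\<dots> \<le> (\<Sum>z=1..L. exp (l * real (\<xi> z)) * (exp (exp l - 1) / real L))"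
    by (intro sum_mono mult_left_mono mgf_arrivals_indicator) (use assms L in auto)
  also have "\<dots> = exp (exp l - 1) * mean_exp l L \<xi>"
    by (simp add: mean_exp_def sum_divide_distrib sum_distrib_left mult.commute)
  finally show ?thesis .
qed

text \<open>
  What the first and the second extra ball have in common: the ball waits while its site is busy, and
  otherwise jumps to the destination drawn at some site that is empty in the background.
\<close>

definition tracks :: "nat \<Rightarrow> nat \<Rightarrow> ((nat \<Rightarrow> nat) \<times> nat \<times> nat \<Rightarrow> nat) \<Rightarrow> bool" where
  "tracks L N p \<longleftrightarrow> (\<forall>s. pair_state L N s \<longrightarrow> p s \<in> {1..L} \<and>
     (fst s (p s) > 0 \<longrightarrow> (\<forall>u. p (pair_step L u s) = p s)) \<and>
     (fst s (p s) = 0 \<longrightarrow> (\<exists>w\<in>{1..L}. fst s w = 0 \<and> (\<forall>u. p (pair_step L u s) = u w))))"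

lemma tracks_first: "tracks L N (\<lambda>(\<xi>, x, y). x)"
  by (auto simp: tracks_def pair_state_def pair_step_def)

lemma tracks_second: "tracks L N (\<lambda>(\<xi>, x, y). y)"
  unfolding tracks_def
proof (intro allI impI)
  fix s assume "pair_state L N s"
  then obtain \<xi> x y where s: "s = (\<xi>, x, y)" "x \<in> {1..L}" "y \<in> {1..L}"
    by (auto simp: pair_state_def)
  show "(case s of (\<xi>, x, y) \<Rightarrow> y) \<in> {1..L} \<and>
     (fst s (case s of (\<xi>, x, y) \<Rightarrow> y) > 0 \<longrightarrow>
       (\<forall>u. (case pair_step L u s of (\<xi>, x, y) \<Rightarrow> y) = (case s of (\<xi>, x, y) \<Rightarrow> y))) \<and>
     (fst s (case s of (\<xi>, x, y) \<Rightarrow> y) = 0 \<longrightarrow>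
       (\<exists>w\<in>{1..L}. fst s w = 0 \<and> (\<forall>u. (case pair_step L u s of (\<xi>, x, y) \<Rightarrow> y) = u w)))"
    using s by (cases "\<xi> x = 0") (auto simp: pair_step_def)
qed

lemma tracksD:
  assumes "tracks L N p" "pair_state L N s"
  shows "p s \<in> {1..L}"
    and "fst s (p s) > 0 \<Longrightarrow> p (pair_step L u s) = p s"
    and "fst s (p s) = 0 \<Longrightarrow> \<exists>w\<in>{1..L}. fst s w = 0 \<and> (\<forall>u. p (pair_step L u s) = u w)"
  using assms unfolding tracks_def by blast+

lemma fst_pair_step: "fst (pair_step L u s) = rbb_step L u (fst s)"
  by (simp add: pair_step_def split: prod.splits)

lemma pair_state_fst: "pair_state L N s \<Longrightarrow> fst s \<in> rbb_configs L N"
  by (auto simp: pair_state_def)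

lemma pair_op_track_le:
  assumes "tracks L N p" "pair_state L N s" "l \<ge> 0"
  shows "pair_op L (\<lambda>s. exp (l * real (fst s (p s)))) s
         \<le> exp (exp l - 1) * (exp (l * real (fst s (p s))) + mean_exp l L (fst s))"
proof (cases "fst s (p s) = 0")
  case True
  then obtain w where w: "w \<in> {1..L}" "fst s w = 0" "\<And>u. p (pair_step L u s) = u w"
    using tracksD(3)[OF assms(1,2)] by blast
  have "pair_op L (\<lambda>s. exp (l * real (fst s (p s)))) s \<le> exp (exp l - 1) * mean_exp l L (fst s)"
    unfolding step_op_def w(3) fst_pair_step by (rule exp_jump_le[where \<xi> = "fst s", OF w(1,2) assms(3)])
  also have "\<dots> \<le> exp (exp l - 1) * (exp (l * real (fst s (p s))) + mean_exp l L (fst s))"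
    by (intro mult_left_mono) auto
  finally show ?thesis .
next
  case False
  then have p: "p s \<in> {1..L}" "\<And>u. p (pair_step L u s) = p s"
    using tracksD(1,2)[OF assms(1,2)] by auto
  have "pair_op L (\<lambda>s. exp (l * real (fst s (p s)))) s = rbb_op L (\<lambda>\<xi>. exp (l * real (\<xi> (p s)))) (fst s)"
    by (simp add: step_op_def p fst_pair_step)
  also have "\<dots> \<le> exp (exp l - 1) * exp (l * real (fst s (p s)))"
    by (rule rbb_op_exp_le[OF p(1) assms(3)])
  also have "\<dots> \<le> exp (exp l - 1) * (exp (l * real (fst s (p s))) + mean_exp l L (fst s))"
    by (intro mult_left_mono) (auto simp: mean_exp_nonneg)
  finally show ?thesis .
qed

lemma pair_op_pow_track_le:
  assumes "tracks L N p" "pair_state L N s" "l \<ge> 0"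
  shows "(pair_op L ^^ n) (\<lambda>s. exp (l * real (fst s (p s)))) s
         \<le> (2 * exp (exp l - 1)) ^ n * (exp (l * real (fst s (p s))) + mean_exp l L (fst s))"
proof -
  define V where "V = (\<lambda>s. exp (l * real (fst s (p s))))"
  define S :: "(nat \<Rightarrow> nat) \<times> nat \<times> nat \<Rightarrow> real" where "S = (\<lambda>s. mean_exp l L (fst s))"
  note mk = markov_op_pair[of L N]
  have "(pair_op L ^^ n) V s \<le> (pair_op L ^^ n) (\<lambda>s. 1 * V s + 1 * S s + 0) s"
    by (rule markov_op_mono[OF markov_op_funpow[OF mk] _ assms(2)]) (auto simp: S_def mean_exp_nonneg)
  also have "\<dots> \<le> (2 * exp (exp l - 1)) ^ n * (1 * V s + 1 * S s + 0)"
  proof (rule markov_op_geometric[OF mk _ _ assms(2)])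
    fix s assume s: "pair_state L N s"
    have L: "L \<ge> 1" using s by (auto simp: pair_state_def)
    have "pair_op L S s = rbb_op L (mean_exp l L) (fst s)"
      using pair_op_background[of 1 L "mean_exp l L" s] by (simp add: S_def)
    also have "\<dots> \<le> exp (exp l - 1) * S s"
      using rbb_op_pow_mean_exp_le[of L 1 l "fst s" "exp (exp l - 1)" 0] L rbb_op_exp_le[OF _ assms(3)]
      by (simp add: S_def)
    finally show "pair_op L (\<lambda>s. 1 * V s + 1 * S s + 0) s \<le> 2 * exp (exp l - 1) * (1 * V s + 1 * S s + 0)"
      using pair_op_track_le[OF assms(1) s assms(3), folded V_def]
      unfolding markov_op_affine[OF mk] by (simp add: S_def V_def algebra_simps) (smt (verit) mult_nonneg_nonneg exp_ge_zero)
  qed simp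
  finally show ?thesis by (simp add: V_def S_def)
qed

text \<open>
  An extra ball below \<open>n\<close> or more balls cannot move within \<open>n\<close> steps, so over that time the number of
  balls above it is the occupation of a fixed site.
\<close>

lemma pair_op_pow_track_busy:
  assumes "tracks L N p" "pair_state L N s" "fst s (p s) \<ge> n"
  shows "(pair_op L ^^ n) (\<lambda>s. f (fst s (p s))) s = (rbb_op L ^^ n) (\<lambda>\<xi>. f (\<xi> (p s))) (fst s)"
  using assms(2,3)
proof (induction n arbitrary: s)
  case (Suc n)
  have p: "p s \<in> {1..L}" "\<And>u. p (pair_step L u s) = p s"
    using tracksD(1,2)[OF assms(1) Suc.prems(1)] Suc.prems(2) by auto
  have "(pair_op L ^^ n) (\<lambda>s. f (fst s (p s))) (pair_step L u s) =
      (rbb_op L ^^ n) (\<lambda>\<xi>. f (\<xi> (p s))) (rbb_step L u (fst s))" if "u \<in> set_pmf (dest_law L)" for u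
  proof -
    have "fst (pair_step L u s) (p (pair_step L u s)) \<ge> n"
      using rbb_step_ge[OF p(1), of "fst s" u] Suc.prems(2) by (simp add: p fst_pair_step)
    from Suc.IH[OF pair_step_state[OF that Suc.prems(1)] this] show ?thesis
      by (simp add: p fst_pair_step)
  qed
  then show ?case by (auto intro!: step_op_cong)
qed simp

text \<open>
  The average over all sites is included because it bounds the cost of a jump of an extra ball.
\<close>

definition pair_weight :: "real \<Rightarrow> real \<Rightarrow> nat \<Rightarrow> (nat \<Rightarrow> nat) \<times> nat \<times> nat \<Rightarrow> real" where
  "pair_weight l A L s = (case s of (\<xi>, x, y) \<Rightarrow>
     exp (l * real (\<xi> x)) + exp (l * real (\<xi> y)) + A * mean_exp l L \<xi>)"

text \<open>
  The sites of the two extra balls contract up to a multiple of the average over all sites, and that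
  average contracts by itself. A large coefficient \<open>A\<close> makes the whole sum contract.
\<close>

lemma pair_weight_drift:
  fixes k :: nat and l \<gamma> B :: real
  assumes "k \<ge> 1" "l > 0" "0 < \<gamma>" "\<gamma> < 1" "B \<ge> 0"
  obtains A \<gamma>' B' :: real where "A > 0" "0 < \<gamma>'" "\<gamma>' < 1" "B' \<ge> 0"
    "\<And>L N s. pair_state L N s \<Longrightarrow>
      (\<And>\<xi> z. \<xi> \<in> rbb_configs L N \<Longrightarrow> z \<in> {1..L} \<Longrightarrow>
         (rbb_op L ^^ k) (\<lambda>\<xi>. exp (l * real (\<xi> z))) \<xi> \<le> \<gamma> * exp (l * real (\<xi> z)) + B) \<Longrightarrow>
      (pair_op L ^^ k) (pair_weight l A L) s \<le> \<gamma>' * pair_weight l A L s + B'"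
proof -
  define M where "M = (2 * exp (exp l - 1)) ^ k"
  have M: "M > 0" by (simp add: M_def)
  define B1 where "B1 = B + M * exp (l * real k)"
  have B1: "B1 \<ge> 0" using assms M by (simp add: B1_def)
  \<comment> \<open>Chosen such that the term \<open>2 * M\<close> created by the two jumps fits between \<open>A * \<gamma>\<close> and \<open>A * \<gamma>'\<close>.\<close>
  define A where "A = 4 * M / (1 - \<gamma>)"
  have A: "A > 0" using M assms by (simp add: A_def)
  define \<gamma>' where "\<gamma>' = (1 + \<gamma>) / 2"
  have A\<gamma>: "2 * M + A * \<gamma> = A * \<gamma>'" using assms by (simp add: A_def \<gamma>'_def field_simps)
  define B' where "B' = 2 * B1 + A * B"
  show ?thesis
  proof (rule that[of A \<gamma>' B'])
    show "B' \<ge> 0" using A B1 assms by (simp add: B'_def)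
    fix L N s
    assume s: "pair_state L N s" and drift: "\<And>\<xi> z. \<xi> \<in> rbb_configs L N \<Longrightarrow> z \<in> {1..L} \<Longrightarrow>
         (rbb_op L ^^ k) (\<lambda>\<xi>. exp (l * real (\<xi> z))) \<xi> \<le> \<gamma> * exp (l * real (\<xi> z)) + B"
    note mk = markov_op_funpow[OF markov_op_pair[of L N], of k]
    let ?S = "mean_exp l L (fst s)"
    have track: "(pair_op L ^^ k) (\<lambda>s. exp (l * real (fst s (p s)))) s \<le>
        \<gamma> * exp (l * real (fst s (p s))) + B1 + M * ?S" if p: "tracks L N p" for p
    proof (cases "fst s (p s) \<ge> k")
      case True
      have "p s \<in> {1..L}" by (rule tracksD(1)[OF p s])
      then have "(pair_op L ^^ k) (\<lambda>s. exp (l * real (fst s (p s)))) s \<le> \<gamma> * exp (l * real (fst s (p s))) + B"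
        unfolding pair_op_pow_track_busy[OF p s True, of "\<lambda>a. exp (l * real a)"]
        by (rule drift[OF pair_state_fst[OF s]])
      also have "\<dots> \<le> \<gamma> * exp (l * real (fst s (p s))) + B1 + M * ?S"
        using M mean_exp_nonneg[of l L "fst s"] by (simp add: B1_def)
      finally show ?thesis .
    next
      case False
      have "(pair_op L ^^ k) (\<lambda>s. exp (l * real (fst s (p s)))) s \<le> M * (exp (l * real (fst s (p s))) + ?S)"
        unfolding M_def by (rule pair_op_pow_track_le[OF p s]) (use assms in simp)
      also have "\<dots> \<le> M * (exp (l * real k) + ?S)"
        using False M assms by (intro mult_left_mono add_right_mono) auto
      also have "\<dots> \<le> \<gamma> * exp (l * real (fst s (p s))) + B1 + M * ?S"
        using assms by (simp add: B1_def distrib_left)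
      finally show ?thesis .
    qed
    have S: "(pair_op L ^^ k) (\<lambda>s. mean_exp l L (fst s)) s \<le> \<gamma> * ?S + B"
      unfolding pair_op_background
      by (rule rbb_op_pow_mean_exp_le[OF drift[OF pair_state_fst[OF s]]])
         (use s in \<open>auto simp: pair_state_def\<close>)
    have "pair_weight l A L = (\<lambda>s. 1 * (1 * exp (l * real (fst s ((\<lambda>(\<xi>, x, y). x) s))) +
        1 * exp (l * real (fst s ((\<lambda>(\<xi>, x, y). y) s))) + 0) + A * mean_exp l L (fst s) + 0)"
      by (auto simp: pair_weight_def fun_eq_iff)
    then have "(pair_op L ^^ k) (pair_weight l A L) s =
        (pair_op L ^^ k) (\<lambda>s. exp (l * real (fst s ((\<lambda>(\<xi>, x, y). x) s)))) s +
        (pair_op L ^^ k) (\<lambda>s. exp (l * real (fst s ((\<lambda>(\<xi>, x, y). y) s)))) s +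
        A * (pair_op L ^^ k) (\<lambda>s. mean_exp l L (fst s)) s"
      by (simp only: markov_op_affine[OF mk]) simp
    also have "\<dots> \<le> (\<gamma> * exp (l * real (fst s ((\<lambda>(\<xi>, x, y). x) s))) + B1 + M * ?S) +
        (\<gamma> * exp (l * real (fst s ((\<lambda>(\<xi>, x, y). y) s))) + B1 + M * ?S) + A * (\<gamma> * ?S + B)"
      using A by (intro add_mono mult_left_mono track tracks_first tracks_second S) auto
    also have "\<dots> = \<gamma> * exp (l * real (fst s ((\<lambda>(\<xi>, x, y). x) s))) +
        \<gamma> * exp (l * real (fst s ((\<lambda>(\<xi>, x, y). y) s))) + (2 * M + A * \<gamma>) * ?S + B'"
      by (simp add: B'_def algebra_simps)
    also have "\<dots> \<le> \<gamma>' * exp (l * real (fst s ((\<lambda>(\<xi>, x, y). x) s))) +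
        \<gamma>' * exp (l * real (fst s ((\<lambda>(\<xi>, x, y). y) s))) + (2 * M + A * \<gamma>) * ?S + B'"
      using assms by (intro add_right_mono add_mono mult_right_mono) (auto simp: \<gamma>'_def)
    also have "\<dots> = \<gamma>' * pair_weight l A L s + B'"
      unfolding A\<gamma> by (auto simp: pair_weight_def algebra_simps split: prod.splits)
    finally show "(pair_op L ^^ k) (pair_weight l A L) s \<le> \<gamma>' * pair_weight l A L s + B'" .
  qed (use A assms in \<open>auto simp: \<gamma>'_def\<close>)
qed

section \<open>Meeting from a bounded state\<close>

abbreviation met :: "(nat \<Rightarrow> nat) \<times> nat \<times> nat \<Rightarrow> real" where
  "met \<equiv> (\<lambda>s. of_bool (fst (snd s) = snd (snd s)))"

lemma markov_op_pair_met:
  "markov_op (\<lambda>s. pair_state L N s \<and> fst (snd s) = snd (snd s)) (pair_op L)"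
  by (rule markov_op_step) (auto simp: pair_step_state, auto simp: pair_step_def)

text \<open>
  Absorption means that the states with \<open>P\<close> are again closed under the dynamics, which is what the
  second hypothesis says.
\<close>

lemma absorbed_mono:
  assumes "markov_op I \<Phi>" "markov_op (\<lambda>s. I s \<and> P s) \<Phi>" "I s" "m \<le> n"
  shows "(\<Phi> ^^ m) (\<lambda>s. of_bool (P s)) s \<le> (\<Phi> ^^ n) (\<lambda>s. of_bool (P s)) s"
  using assms(4)
proof (induction n rule: dec_induct)
  case (step n)
  have "of_bool (P s) \<le> \<Phi> (\<lambda>s. of_bool (P s)) s" if "I s" for s
  proof (cases "P s")
    case True
    then show ?thesis using markov_op_ge_const[OF assms(2), of 1 "\<lambda>s. of_bool (P s)" s] that by simp
  next
    case False
    then show ?thesis using markov_op_ge_const[OF assms(1), of 0 "\<lambda>s. of_bool (P s)" s] that by simp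
  qed
  from markov_op_mono[OF markov_op_funpow[OF assms(1), of n] this assms(3)]
  have "(\<Phi> ^^ n) (\<lambda>s. of_bool (P s)) s \<le> (\<Phi> ^^ Suc n) (\<lambda>s. of_bool (P s)) s"
    by (simp add: funpow_swap1)
  with step.IH show ?case by linarith
qed simp

lemma pair_op_met_mono:
  "pair_state L N s \<Longrightarrow> m \<le> n \<Longrightarrow> (pair_op L ^^ m) met s \<le> (pair_op L ^^ n) met s"
  by (rule absorbed_mono[OF markov_op_pair[of L N] markov_op_pair_met])

lemma pair_op_pow_met_nonneg: "pair_state L N s \<Longrightarrow> 0 \<le> (pair_op L ^^ n) met s"
  by (rule markov_op_ge_const[OF markov_op_funpow[OF markov_op_pair]]) auto

text \<open>
  If no ball arrives at either site, both sites run empty at the same time and the extra balls jump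
  together.
\<close>

lemma meet_from_equal_heights:
  assumes "L \<ge> 4" "pair_state L N (\<xi>, x, y)" "\<xi> x = c" "\<xi> y = c"
  shows "exp (-4) ^ c \<le> (pair_op L ^^ Suc c) met (\<xi>, x, y)"
  using assms(2-)
proof (induction c arbitrary: \<xi> x y)
  case 0
  then show ?case by (simp add: step_op_def pair_step_def)
next
  case (Suc c)
  have xy: "x \<in> {1..L}" "y \<in> {1..L}" using Suc.prems by (auto simp: pair_state_def)
  have "(exp (-4) :: real) ^ Suc c \<le> measure_pmf.expectation (dest_law L) (\<lambda>u. exp (-4) ^ c * of_bool (\<forall>w\<in>{1..L}. u w \<notin> {x, y}))"
    using mult_left_mono[OF prob_avoid_ge[OF assms(1), of x y], of "exp (-4) ^ c"] by (simp add: mult.commute)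
  also have "\<dots> \<le> pair_op L ((pair_op L ^^ Suc c) met) (\<xi>, x, y)"
    unfolding step_op_def[of L "pair_step L" "(pair_op L ^^ Suc c) met"]
  proof (rule dest_expectation_mono)
    fix u assume u: "u \<in> set_pmf (dest_law L)"
    note st = pair_step_state[OF u Suc.prems(1)]
    show "exp (-4) ^ c * of_bool (\<forall>w\<in>{1..L}. u w \<notin> {x, y}) \<le> (pair_op L ^^ Suc c) met (pair_step L u (\<xi>, x, y))"
    proof (cases "\<forall>w\<in>{1..L}. u w \<notin> {x, y}")
      case True
      then have *: "rbb_step L u \<xi> x = c" "rbb_step L u \<xi> y = c"
        using Suc.prems xy arrivals_eq_0 by (auto simp: rbb_step_arrivals)
      have "pair_step L u (\<xi>, x, y) = (rbb_step L u \<xi>, x, y)"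
        using Suc.prems by (simp add: pair_step_def)
      then show ?thesis using Suc.IH[where \<xi> = "rbb_step L u \<xi>", OF _ *] st True by simp
    next
      case False
      then have zero: "of_bool (\<forall>w\<in>{1..L}. u w \<notin> {x, y}) = (0::real)"
        by (simp only: of_bool_eq_0_iff not_False_eq_True)
      show ?thesis unfolding zero using pair_op_pow_met_nonneg[OF st, of "Suc c"] by simp
    qed
  qed
  finally show ?case by simp
qed

definition busy :: "nat \<Rightarrow> (nat \<Rightarrow> nat) \<Rightarrow> nat set" where
  "busy L \<xi> = {y \<in> {1..L}. \<xi> y > 0}"

lemma sum_of_bool_card: "finite A \<Longrightarrow> (\<Sum>z\<in>A. of_bool (Q z)) = real (card {z \<in> A. Q z})"
  by (simp add: Int_def)

lemma arrivals_card: "arrivals L u \<xi> z = card {y \<in> busy L \<xi>. u y = z}"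
proof -
  have "arrivals L u \<xi> z = (\<Sum>y=1..L. of_bool (y \<in> {y \<in> busy L \<xi>. u y = z}))"
    unfolding arrivals_def by (rule sum.cong) (auto simp: busy_def)
  also have "\<dots> = card ({1..L} \<inter> {y \<in> busy L \<xi>. u y = z})"
    by (simp add: of_bool_def sum.If_cases Collect_conj_eq)
  also have "{1..L} \<inter> {y \<in> busy L \<xi>. u y = z} = {y \<in> busy L \<xi>. u y = z}"
    by (auto simp: busy_def)
  finally show ?thesis .
qed

lemma prod_indicator_power:
  assumes "finite A" "D \<subseteq> A"
  shows "(\<Prod>y\<in>A. if y \<in> D then a else 1) = (a :: real) ^ card D"
proof -
  have "A \<inter> D = D" using assms by auto
  then show ?thesis using assms(1) by (simp add: prod.If_cases)
qed

text \<open>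
  The prescribed destinations on \<open>J\<close> are those of sites that are empty, so they do not interfere with the
  arrivals; they are used to fix where an extra ball jumps. The \<open>d\<close> balls that go to \<open>p\<close> can be chosen
  in a binomial number of ways, and the other balls have to avoid \<open>p\<close> and \<open>q\<close>.
\<close>

lemma prob_arrivals_ge:
  assumes "L \<ge> 4" "p \<in> {1..L}" "q \<noteq> p" "z \<in> {1..L}" "J \<subseteq> {1..L}" "J \<inter> busy L \<xi> = {}"
  shows "real (card (busy L \<xi>) choose d) * (1 / real L) ^ d * (1 / real L) ^ card J * exp (-4) \<le>
    measure_pmf.expectation (dest_law L)
      (\<lambda>u. of_bool (arrivals L u \<xi> p = d \<and> arrivals L u \<xi> q = 0 \<and> (\<forall>y\<in>J. u y = z)))"
proof -
  let ?O = "busy L \<xi>"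
  have O: "finite ?O" "?O \<subseteq> {1..L}" by (auto simp: busy_def)
  define Ds where "Ds = {D. D \<subseteq> ?O \<and> card D = d}"
  have Ds: "finite Ds" "card Ds = card ?O choose d"
    using n_subsets[OF O(1), of d] O(1) by (auto simp: Ds_def)
  define F where "F = (\<lambda>D y. if y \<in> D then {p} else if y \<in> ?O then - {p, q} else if y \<in> J then {z} else UNIV)"
  define G where "G = (\<lambda>u. arrivals L u \<xi> p = d \<and> arrivals L u \<xi> q = 0 \<and> (\<forall>y\<in>J. u y = z))"
  have one: "(1 / real L) ^ d * (1 / real L) ^ card J * exp (-4) \<le>
      measure_pmf.expectation (dest_law L) (\<lambda>u. of_bool (\<forall>y\<in>{1..L}. u y \<in> F D y))" if D: "D \<in> Ds" for D
  proof -
    have D': "D \<subseteq> ?O" "card D = d" "D \<subseteq> {1..L}" using D O by (auto simp: Ds_def)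
    have "(1 / real L) ^ d * (1 / real L) ^ card J * exp (-4) \<le>
        (\<Prod>y=1..L. if y \<in> D then 1 / real L else 1) * (\<Prod>y=1..L. if y \<in> J then 1 / real L else 1) * (1 - 2 / real L) ^ L"
      using one_minus_power_ge[OF assms(1)] D' assms(5)
      by (subst (1 2) prod_indicator_power) (auto intro!: mult_left_mono)
    also have "\<dots> = (\<Prod>y=1..L. (if y \<in> D then 1 / real L else 1) * (if y \<in> J then 1 / real L else 1) * (1 - 2 / real L))"
      by (simp add: prod.distrib)
    also have "\<dots> \<le> (\<Prod>y=1..L. real (card (F D y \<inter> {1..L})) / real L)"
    proof (rule prod_mono)
      fix y assume y: "y \<in> {1..L}"
      have L: "1 - 2 / real L \<le> 1" "0 \<le> 1 - 2 / real L" using assms(1) by (auto simp: field_simps)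
      have c2: "1 - 2 / real L \<le> real (card (- {p, q} \<inter> {1..L})) / real L"
        by (rule fraction_avoid_ge) (use assms(1) in simp)
      have pz: "{p} \<inter> {1..L} = {p}" "{z} \<inter> {1..L} = {z}" using assms(2,4) by auto
      consider "y \<in> D" "y \<notin> J" | "y \<notin> D" "y \<in> ?O" "y \<notin> J" | "y \<notin> D" "y \<notin> ?O" "y \<in> J" | "y \<notin> D" "y \<notin> ?O" "y \<notin> J"
        using D' assms(6) by blast
      then show "0 \<le> (if y \<in> D then 1 / real L else 1) * (if y \<in> J then 1 / real L else 1) * (1 - 2 / real L) \<and>
        (if y \<in> D then 1 / real L else 1) * (if y \<in> J then 1 / real L else 1) * (1 - 2 / real L)
           \<le> real (card (F D y \<inter> {1..L})) / real L"
      proof cases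
        case 1
        have "1 / real L * (1 - 2 / real L) \<le> 1 / real L * 1" by (rule mult_left_mono) (use L in auto)
        then show ?thesis using 1 L pz by (simp add: F_def)
      next
        case 2
        then show ?thesis using L c2 by (simp add: F_def)
      next
        case 3
        have "1 / real L * (1 - 2 / real L) \<le> 1 / real L * 1" by (rule mult_left_mono) (use L in auto)
        then show ?thesis using 3 L pz by (simp add: F_def)
      next
        case 4
        then show ?thesis using L assms(1) by (simp add: F_def)
      qed
    qed
    also have "\<dots> = measure_pmf.expectation (dest_law L) (\<lambda>u. of_bool (\<forall>y\<in>{1..L}. u y \<in> F D y))"
      by (rule dest_prob_product[symmetric]) (use assms(1) in simp)
    finally show ?thesis .
  qed
  have "real (card ?O choose d) * (1 / real L) ^ d * (1 / real L) ^ card J * exp (-4) =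
      (\<Sum>D\<in>Ds. (1 / real L) ^ d * (1 / real L) ^ card J * exp (-4))"
    using Ds by simp
  also have "\<dots> \<le> (\<Sum>D\<in>Ds. measure_pmf.expectation (dest_law L) (\<lambda>u. of_bool (\<forall>y\<in>{1..L}. u y \<in> F D y)))"
    by (rule sum_mono) (rule one)
  also have "\<dots> = measure_pmf.expectation (dest_law L) (\<lambda>u. \<Sum>D\<in>Ds. of_bool (\<forall>y\<in>{1..L}. u y \<in> F D y))"
    by (rule Bochner_Integration.integral_sum[symmetric]) simp
  also have "\<dots> \<le> measure_pmf.expectation (dest_law L) (\<lambda>u. of_bool (G u))"
  proof (rule dest_expectation_mono)
    fix u
    \<comment> \<open>The events for different \<open>D\<close> are disjoint, as \<open>u\<close> determines \<open>D\<close>.\<close>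
    define Du where "Du = {y \<in> ?O. u y = p}"
    have "of_bool (\<forall>y\<in>{1..L}. u y \<in> F D y) \<le> (if D = Du then of_bool (G u) else (0::real))" if D: "D \<in> Ds" for D
    proof (cases "\<forall>y\<in>{1..L}. u y \<in> F D y")
      case True
      have D': "D \<subseteq> ?O" "card D = d" using D by (auto simp: Ds_def)
      have eq: "D = Du"
      proof (intro equalityI subsetI)
        fix y assume y: "y \<in> D"
        then have "y \<in> {1..L}" "y \<in> ?O" using D' O by auto
        then show "y \<in> Du" using True y by (force simp: F_def Du_def)
      next
        fix y assume y: "y \<in> Du"
        then have "y \<in> {1..L}" "y \<in> ?O" "u y = p" using O by (auto simp: Du_def)
        then show "y \<in> D" using True by (force simp: F_def split: if_splits)
      qed
      have q: "{y \<in> ?O. u y = q} = {}"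
      proof -
        have "u y \<noteq> q" if y: "y \<in> ?O" for y
        proof -
          have "u y \<in> F D y" using True y O by blast
          then show ?thesis using assms(3) y by (auto simp: F_def split: if_splits)
        qed
        then show ?thesis by blast
      qed
      have "u y = z" if y: "y \<in> J" for y
      proof -
        have "y \<notin> ?O" "y \<notin> D" "u y \<in> F D y" using True y assms(5,6) D' by auto
        then show ?thesis using y by (simp add: F_def)
      qed
      then have "G u" using D' eq unfolding G_def arrivals_card q by (simp add: Du_def)
      then show ?thesis using eq by simp
    next
      case False
      then have zero: "of_bool (\<forall>y\<in>{1..L}. u y \<in> F D y) = (0::real)"
        by (simp only: of_bool_eq_0_iff not_False_eq_True)
      show ?thesis unfolding zero by simp
    qed
    then have "(\<Sum>D\<in>Ds. of_bool (\<forall>y\<in>{1..L}. u y \<in> F D y)) \<le> (\<Sum>D\<in>Ds. if D = Du then of_bool (G u) else (0::real))"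
      by (rule sum_mono)
    also have "\<dots> \<le> of_bool (G u)" using Ds(1) by simp
    finally show "(\<Sum>D\<in>Ds. of_bool (\<forall>y\<in>{1..L}. u y \<in> F D y)) \<le> (of_bool (G u) :: real)" .
  qed
  finally show ?thesis by (simp add: G_def)
qed

text \<open>
  With \<open>n\<close> of order \<open>L\<close> balls and success probability \<open>1 / L\<close>, a bounded number of successes has a
  probability bounded away from zero.
\<close>

lemma binomial_frac_ge:
  fixes \<kappa> :: real
  assumes "0 < \<kappa>" "\<kappa> \<le> 1" "\<kappa> * real L \<le> real n" "d \<le> C" "d \<le> n" "C \<ge> 1" "L \<ge> 1"
  shows "(\<kappa> / real C) ^ C \<le> real (n choose d) * (1 / real L) ^ d"
proof (cases "d = 0")
  case True
  have "\<kappa> / real C \<le> 1" using assms by (simp add: field_simps)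
  then show ?thesis using True assms by (simp add: power_le_one)
next
  case False
  have "(\<kappa> / real C) ^ C \<le> (\<kappa> / real C) ^ d"
    using assms by (intro power_decreasing) (auto simp: field_simps)
  also have "\<dots> \<le> (\<kappa> / real d) ^ d"
    using assms False by (intro power_mono divide_left_mono) auto
  also have "\<dots> \<le> (real n / real d * (1 / real L)) ^ d"
    using assms False by (intro power_mono) (auto simp: field_simps)
  also have "\<dots> = (real n / real d) ^ d * (1 / real L) ^ d" by (rule power_mult_distrib)
  also have "\<dots> \<le> real (n choose d) * (1 / real L) ^ d"
    by (intro mult_right_mono binomial_ge_n_over_k_pow_k assms) auto
  finally show ?thesis .
qed

text \<open>
  The lower of the two sites receives exactly the missing number of balls and the higher one none.
\<close>

lemma prob_equalise_ge:
  fixes \<kappa> :: real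
  assumes "L \<ge> 4" "a \<in> {1..L}" "b \<in> {1..L}" "a \<noteq> b" "\<xi> a \<le> C" "\<xi> b \<le> C" "C \<ge> 1"
    "z \<in> {1..L}" "J \<subseteq> {1..L}" "J \<inter> busy L \<xi> = {}"
    "0 < \<kappa>" "\<kappa> \<le> 1" "\<kappa> * real L \<le> real (card (busy L \<xi>))" "real C \<le> \<kappa> * real L"
  shows "(\<kappa> / real C) ^ C * exp (-4) * (1 / real L) ^ card J \<le>
    measure_pmf.expectation (dest_law L)
      (\<lambda>u. of_bool (rbb_step L u \<xi> a = rbb_step L u \<xi> b \<and> rbb_step L u \<xi> a \<le> C \<and> (\<forall>y\<in>J. u y = z)))"
proof -
  \<comment> \<open>The heights after the departures and before the arrivals.\<close>
  define h where "h = (\<lambda>w. \<xi> w - of_bool (\<xi> w > 0))"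
  have *: "(\<kappa> / real C) ^ C * exp (-4) * (1 / real L) ^ card J \<le>
    measure_pmf.expectation (dest_law L)
      (\<lambda>u. of_bool (rbb_step L u \<xi> p = rbb_step L u \<xi> q \<and> rbb_step L u \<xi> p \<le> C \<and> (\<forall>y\<in>J. u y = z)))"
    if pq: "p \<in> {1..L}" "q \<in> {1..L}" "p \<noteq> q" "h p \<le> h q" "\<xi> q \<le> C" for p q
  proof -
    define d where "d = h q - h p"
    have d: "d \<le> C" "d \<le> card (busy L \<xi>)"
      using pq(5) assms(13,14) by (auto simp: d_def h_def)
    have "(\<kappa> / real C) ^ C * exp (-4) * (1 / real L) ^ card J \<le>
       real (card (busy L \<xi>) choose d) * (1 / real L) ^ d * exp (-4) * (1 / real L) ^ card J"
      using assms d by (intro mult_right_mono binomial_frac_ge) auto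
    also have "\<dots> = real (card (busy L \<xi>) choose d) * (1 / real L) ^ d * (1 / real L) ^ card J * exp (-4)"
      by simp
    also have "\<dots> \<le> measure_pmf.expectation (dest_law L)
      (\<lambda>u. of_bool (arrivals L u \<xi> p = d \<and> arrivals L u \<xi> q = 0 \<and> (\<forall>y\<in>J. u y = z)))"
      by (rule prob_arrivals_ge) (use assms pq in auto)
    also have "\<dots> \<le> measure_pmf.expectation (dest_law L)
      (\<lambda>u. of_bool (rbb_step L u \<xi> p = rbb_step L u \<xi> q \<and> rbb_step L u \<xi> p \<le> C \<and> (\<forall>y\<in>J. u y = z)))"
      by (rule dest_expectation_mono)
         (use pq in \<open>auto simp: rbb_step_arrivals d_def h_def\<close>)
    finally show ?thesis .
  qed
  show ?thesis
  proof (cases "h a \<le> h b")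
    case True
    then show ?thesis using *[of a b] assms by simp
  next
    case False
    then have "(\<kappa> / real C) ^ C * exp (-4) * (1 / real L) ^ card J \<le>
    measure_pmf.expectation (dest_law L)
      (\<lambda>u. of_bool (rbb_step L u \<xi> b = rbb_step L u \<xi> a \<and> rbb_step L u \<xi> b \<le> C \<and> (\<forall>y\<in>J. u y = z)))"
      using *[of b a] assms by simp
    also have "\<dots> \<le> measure_pmf.expectation (dest_law L)
      (\<lambda>u. of_bool (rbb_step L u \<xi> a = rbb_step L u \<xi> b \<and> rbb_step L u \<xi> a \<le> C \<and> (\<forall>y\<in>J. u y = z)))"
      by (rule dest_expectation_mono) auto
    finally show ?thesis .
  qed
qed

text \<open>
  The same with one of the sites replaced by the landing point of an extra ball that leaves \<open>w\<close>: at
  least a quarter of all sites are low enough, and the events for different landing points are disjoint.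
\<close>

lemma prob_jump_equalise_ge:
  fixes \<kappa> :: real
  assumes "L \<ge> 4" "b \<in> {1..L}" "\<xi> b \<le> C" "C \<ge> 1" "w \<in> {1..L}" "\<xi> w = 0"
    "0 < \<kappa>" "\<kappa> \<le> 1" "\<kappa> * real L \<le> real (card (busy L \<xi>))" "real C \<le> \<kappa> * real L"
    "\<xi> \<in> rbb_configs L N" "real N \<le> r * real L" "2 * r \<le> real C"
  shows "(\<kappa> / real C) ^ C * exp (-4) / 4 \<le>
    measure_pmf.expectation (dest_law L)
      (\<lambda>u. of_bool (rbb_step L u \<xi> (u w) = rbb_step L u \<xi> b \<and> rbb_step L u \<xi> (u w) \<le> C))"
proof -
  define c where "c = (\<kappa> / real C) ^ C * exp (-4)"
  have c: "c \<ge> 0" using assms by (simp add: c_def)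
  define Z where "Z = {z \<in> {1..L}. \<xi> z \<le> C} - {b}"
  have fin: "finite Z" by (simp add: Z_def)
  have "real L / 2 \<le> real (card {z \<in> {1..L}. \<xi> z \<le> C})"
    using card_small_sites_ge[OF assms(11,12,13)] by (simp only: sum_of_bool_card finite_atLeastAtMost)
  moreover have "card {z \<in> {1..L}. \<xi> z \<le> C} - 1 \<le> card Z"
    unfolding Z_def using diff_card_le_card_Diff[of "{b}" "{z \<in> {1..L}. \<xi> z \<le> C}"] by simp
  ultimately have Z: "real L / 4 \<le> real (card Z)" using assms(1) by linarith
  have "c / 4 = real L / 4 * (c * (1 / real L))" using assms(1) by simp
  also have "\<dots> \<le> real (card Z) * (c * (1 / real L))"
    using Z c by (intro mult_right_mono) auto
  also have "\<dots> = (\<Sum>z\<in>Z. c * (1 / real L) ^ card {w})" by simp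
  also have "\<dots> \<le> (\<Sum>z\<in>Z. measure_pmf.expectation (dest_law L)
      (\<lambda>u. of_bool (rbb_step L u \<xi> z = rbb_step L u \<xi> b \<and> rbb_step L u \<xi> z \<le> C \<and> (\<forall>y\<in>{w}. u y = z))))"
    unfolding c_def
    by (intro sum_mono prob_equalise_ge) (use assms in \<open>auto simp: Z_def busy_def\<close>)
  also have "\<dots> = measure_pmf.expectation (dest_law L)
      (\<lambda>u. \<Sum>z\<in>Z. of_bool (rbb_step L u \<xi> z = rbb_step L u \<xi> b \<and> rbb_step L u \<xi> z \<le> C \<and> (\<forall>y\<in>{w}. u y = z)))"
    by (rule Bochner_Integration.integral_sum[symmetric]) simp
  also have "\<dots> \<le> measure_pmf.expectation (dest_law L)
      (\<lambda>u. of_bool (rbb_step L u \<xi> (u w) = rbb_step L u \<xi> b \<and> rbb_step L u \<xi> (u w) \<le> C))"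
  proof (rule dest_expectation_mono)
    fix u
    have "(\<Sum>z\<in>Z. of_bool (rbb_step L u \<xi> z = rbb_step L u \<xi> b \<and> rbb_step L u \<xi> z \<le> C \<and> (\<forall>y\<in>{w}. u y = z))) \<le>
        (\<Sum>z\<in>Z. if z = u w then of_bool (rbb_step L u \<xi> (u w) = rbb_step L u \<xi> b \<and> rbb_step L u \<xi> (u w) \<le> C) else (0::real))"
      by (intro sum_mono) auto
    also have "\<dots> \<le> of_bool (rbb_step L u \<xi> (u w) = rbb_step L u \<xi> b \<and> rbb_step L u \<xi> (u w) \<le> C)"
      using fin by simp
    finally show "(\<Sum>z\<in>Z. of_bool (rbb_step L u \<xi> z = rbb_step L u \<xi> b \<and> rbb_step L u \<xi> z \<le> C \<and> (\<forall>y\<in>{w}. u y = z)))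
      \<le> (of_bool (rbb_step L u \<xi> (u w) = rbb_step L u \<xi> b \<and> rbb_step L u \<xi> (u w) \<le> C) :: real)" .
  qed
  finally show ?thesis by (simp add: c_def)
qed

text \<open>
  One step equalises the heights above the two extra balls, after a jump of one of them if necessary; then
  both sites drain undisturbed until they are empty simultaneously.
\<close>

lemma meet_from_bounded_heights:
  fixes \<kappa> :: real
  assumes "L \<ge> 4" "pair_state L N (\<xi>, x, y)" "\<xi> x \<le> C" "\<xi> y \<le> C" "C \<ge> 1"
    "0 < \<kappa>" "\<kappa> \<le> 1" "\<kappa> * real L \<le> real (card (busy L \<xi>))" "real C \<le> \<kappa> * real L"
    "real N \<le> r * real L" "2 * r \<le> real C"
  shows "exp (-4) ^ C * ((\<kappa> / real C) ^ C * exp (-4) / 4) \<le> (pair_op L ^^ (C + 2)) met (\<xi>, x, y)"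
proof -
  let ?s = "(\<xi>, x, y)"
  define p where "p = (\<kappa> / real C) ^ C * exp (-4)"
  have "\<kappa> / real C \<le> 1" using assms by (simp add: field_simps)
  then have "(\<kappa> / real C) ^ C \<le> 1" using assms by (intro power_le_one) auto
  then have p: "0 \<le> p" "p \<le> 1" using assms by (auto simp: p_def intro!: mult_le_one)
  have q1: "exp (-4) ^ C \<le> (1::real)" by (intro power_le_one) auto
  have st: "\<xi> \<in> rbb_configs L N" "x \<in> {1..L}" "y \<in> {1..L}"
    using assms(2) by (auto simp: pair_state_def)
  have one: "exp (-4) ^ C * (p / 4) \<le> 1"
    by (rule mult_le_one[OF q1]) (use p in auto)
  have early: ?thesis if "(pair_op L ^^ n) met ?s \<ge> 1" "n \<le> C + 2" for n
    using pair_op_met_mono[OF assms(2) that(2)] that(1) one by (simp add: p_def)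
  show ?thesis
  proof (cases "x = y \<or> \<xi> x = 0 \<and> \<xi> y = 0")
    case True
    show ?thesis
    proof (cases "x = y")
      case True
      then show ?thesis by (intro early[of 0]) auto
    next
      case False
      then show ?thesis
        using True meet_from_equal_heights[OF assms(1,2), of 0] by (intro early[of 1]) auto
    qed
  next
    case False
    define H :: "(nat \<Rightarrow> nat) \<times> nat \<times> nat \<Rightarrow> real" where
      "H = (\<lambda>(\<xi>, x, y). of_bool (\<xi> x = \<xi> y \<and> \<xi> x \<le> C))"
    have H: "exp (-4) ^ C * H s + 0 \<le> (pair_op L ^^ Suc C) met s" if s: "pair_state L N s" for s
    proof (cases s)
      case (fields \<zeta> a b)
      show ?thesis
      proof (cases "\<zeta> a = \<zeta> b \<and> \<zeta> a \<le> C")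
        case True
        have "exp (-4) ^ C \<le> (exp (-4) :: real) ^ \<zeta> a" using True by (intro power_decreasing) auto
        also have "\<dots> \<le> (pair_op L ^^ Suc (\<zeta> a)) met s"
          unfolding fields by (rule meet_from_equal_heights[OF assms(1)]) (use s True fields in auto)
        also have "\<dots> \<le> (pair_op L ^^ Suc C) met s" by (rule pair_op_met_mono[OF s]) (use True in simp)
        finally show ?thesis using True fields by (simp add: H_def del: funpow.simps)
      next
        case False
        then show ?thesis using pair_op_pow_met_nonneg[OF s, of "Suc C"] fields
          by (auto simp: H_def simp del: funpow.simps)
      qed
    qed
    have "p / 4 \<le> pair_op L H ?s"
    proof -
      consider "\<xi> x > 0" "\<xi> y > 0" | "\<xi> x = 0" "\<xi> y > 0" | "\<xi> x > 0" "\<xi> y = 0" using False by blast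
      then show ?thesis
      proof cases
        case 1
        have "p / 4 \<le> p * (1 / real L) ^ card ({} :: nat set)" using p by simp
        also have "\<dots> \<le> measure_pmf.expectation (dest_law L)
            (\<lambda>u. of_bool (rbb_step L u \<xi> x = rbb_step L u \<xi> y \<and> rbb_step L u \<xi> x \<le> C \<and> (\<forall>y\<in>{}. u y = x)))"
          unfolding p_def by (rule prob_equalise_ge) (use assms st False in auto)
        also have "\<dots> = pair_op L H ?s" using 1 by (simp add: step_op_def H_def pair_step_def)
        finally show ?thesis .
      next
        case 2
        have "p / 4 \<le> measure_pmf.expectation (dest_law L)
            (\<lambda>u. of_bool (rbb_step L u \<xi> (u x) = rbb_step L u \<xi> y \<and> rbb_step L u \<xi> (u x) \<le> C))"
          unfolding p_def by (rule prob_jump_equalise_ge) (use assms st 2 in auto)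
        also have "\<dots> = pair_op L H ?s" using 2 by (simp add: step_op_def H_def pair_step_def)
        finally show ?thesis .
      next
        case 3
        have "p / 4 \<le> measure_pmf.expectation (dest_law L)
            (\<lambda>u. of_bool (rbb_step L u \<xi> (u y) = rbb_step L u \<xi> x \<and> rbb_step L u \<xi> (u y) \<le> C))"
          unfolding p_def by (rule prob_jump_equalise_ge) (use assms st 3 in auto)
        also have "\<dots> \<le> pair_op L H ?s" unfolding step_op_def
          by (rule dest_expectation_mono) (use 3 in \<open>auto simp: H_def pair_step_def\<close>)
        finally show ?thesis .
      qed
    qed
    then have "exp (-4) ^ C * (p / 4) \<le> exp (-4) ^ C * pair_op L H ?s + 0" by simp
    also have "\<dots> \<le> pair_op L ((pair_op L ^^ Suc C) met) ?s"
      by (rule markov_op_ge_affine1[OF markov_op_pair[of L N] H assms(2)])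
    finally show ?thesis by (simp add: p_def)
  qed
qed

lemma square_le_exp:
  fixes x l :: real
  assumes "x \<ge> 0" "l > 0"
  shows "x\<^sup>2 \<le> 2 / l\<^sup>2 * exp (l * x)"
proof -
  have nonneg: "0 \<le> l * x" using assms by simp
  have "(l * x)\<^sup>2 / 2 \<le> exp (l * x)"
    using exp_lower_Taylor_quadratic[OF nonneg] nonneg by linarith
  then have "l\<^sup>2 * x\<^sup>2 \<le> 2 * exp (l * x)" by (simp add: power_mult_distrib)
  then show ?thesis using assms by (simp add: pos_le_divide_eq mult.commute)
qed

text \<open>
  A bounded average of \<open>exp (l * \<xi> z)\<close> prevents the balls from concentrating on a vanishing fraction of
  the sites.
\<close>

lemma card_busy_ge:
  fixes r l R :: real
  assumes "r > 0" "l > 0" "R > 0" "\<xi> \<in> rbb_configs L N" "r * real L \<le> real N" "mean_exp l L \<xi> \<le> R" "L \<ge> 1"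
  shows "r\<^sup>2 * l\<^sup>2 / (8 * R) * real L \<le> real (card (busy L \<xi>))"
proof -
  \<comment> \<open>The cut-off above which the sites carry at most half of the balls.\<close>
  define a where "a = 4 * R / (l\<^sup>2 * r)"
  have a: "a > 0" using assms by (simp add: a_def)
  have "r * real L \<le> (\<Sum>z=1..L. real (\<xi> z))"
    using assms(4,5) by (simp add: rbb_configs_def flip: of_nat_sum)
  also have "\<dots> \<le> (\<Sum>z=1..L. a * of_bool (\<xi> z > 0) + 1 / a * (2 / l\<^sup>2) * exp (l * real (\<xi> z)))"
  proof (rule sum_mono)
    fix z
    have "real (\<xi> z) \<le> a * of_bool (\<xi> z > 0) + 1 / a * (real (\<xi> z))\<^sup>2"
    proof (cases "real (\<xi> z) \<le> a")
      case True
      then show ?thesis using a by (cases "\<xi> z = 0") (auto intro!: add_increasing2)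
    next
      case False
      then have "a * real (\<xi> z) \<le> real (\<xi> z) * real (\<xi> z)" by (intro mult_right_mono) auto
      then have "real (\<xi> z) \<le> 1 / a * (real (\<xi> z))\<^sup>2"
        using a by (simp add: field_simps power2_eq_square)
      then show ?thesis using a by (simp add: add_increasing)
    qed
    also have "\<dots> \<le> a * of_bool (\<xi> z > 0) + 1 / a * (2 / l\<^sup>2 * exp (l * real (\<xi> z)))"
      using a assms by (intro add_left_mono mult_left_mono square_le_exp) auto
    finally show "real (\<xi> z) \<le> a * of_bool (\<xi> z > 0) + 1 / a * (2 / l\<^sup>2) * exp (l * real (\<xi> z))" by simp
  qed
  also have "\<dots> = a * real (card (busy L \<xi>)) + 1 / a * (2 / l\<^sup>2) * (real L * mean_exp l L \<xi>)"
  proof -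
    have "(\<Sum>z=1..L. of_bool (\<xi> z > 0)) = real (card (busy L \<xi>))"
      unfolding busy_def by (rule sum_of_bool_card) simp
    moreover have "(\<Sum>z=1..L. exp (l * real (\<xi> z))) = real L * mean_exp l L \<xi>"
      using assms(7) by (simp add: mean_exp_def)
    ultimately show ?thesis by (simp only: sum.distrib sum_distrib_left[symmetric])
  qed
  also have "\<dots> \<le> a * real (card (busy L \<xi>)) + 1 / a * (2 / l\<^sup>2) * (real L * R)"
    using a assms by (intro add_left_mono mult_left_mono) auto
  also have "1 / a * (2 / l\<^sup>2) * (real L * R) = r / 2 * real L"
    using assms by (simp add: a_def field_simps)
  finally have "r / 2 * real L \<le> a * real (card (busy L \<xi>))" by simp
  then have "r / 2 * real L / a \<le> real (card (busy L \<xi>))"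
    using a by (simp add: divide_le_eq mult.commute)
  moreover have "r / 2 * real L / a = r\<^sup>2 * l\<^sup>2 / (8 * R) * real L"
    using assms by (simp add: a_def power2_eq_square)
  ultimately show ?thesis by simp
qed

lemma small_set_meeting:
  fixes r l R :: real
  assumes "r > 0" "l > 0"
  obtains C :: nat and p L0 :: real where "p > 0"
    "\<And>L N \<xi> x y. real L \<ge> L0 \<Longrightarrow> L \<ge> 4 \<Longrightarrow> pair_state L N (\<xi>, x, y) \<Longrightarrow>
       r / 2 * real L \<le> real N \<Longrightarrow> real N \<le> r * real L \<Longrightarrow>
       exp (l * real (\<xi> x)) \<le> R \<Longrightarrow> exp (l * real (\<xi> y)) \<le> R \<Longrightarrow> mean_exp l L \<xi> \<le> R \<Longrightarrow>
       p \<le> (pair_op L ^^ C) met (\<xi>, x, y)"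
proof -
  define C where "C = nat \<lceil>max 1 (max (2 * r) (ln R / l))\<rceil>"
  have C: "C \<ge> 1" "2 * r \<le> real C" "ln R / l \<le> real C"
    unfolding C_def by linarith+
  define \<kappa> where "\<kappa> = min 1 ((r/2)\<^sup>2 * l\<^sup>2 / (8 * max R 1))"
  have \<kappa>: "0 < \<kappa>" "\<kappa> \<le> 1" using assms by (auto simp: \<kappa>_def)
  show ?thesis
  proof (rule that)
    show "exp (-4) ^ C * ((\<kappa> / real C) ^ C * exp (-4) / 4) > 0" using \<kappa> C by simp
    fix L N \<xi> x y
    assume L: "real L \<ge> real C / \<kappa>" "L \<ge> 4" and s: "pair_state L N (\<xi>, x, y)"
      and N: "r / 2 * real L \<le> real N" "real N \<le> r * real L"
      and R: "exp (l * real (\<xi> x)) \<le> R" "exp (l * real (\<xi> y)) \<le> R" "mean_exp l L \<xi> \<le> R"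
    have R1: "R > 0" using R(1) exp_gt_zero[of "l * real (\<xi> x)"] by linarith
    have hC: "\<xi> w \<le> C" if "exp (l * real (\<xi> w)) \<le> R" for w
    proof -
      have "l * real (\<xi> w) \<le> ln R" using that R1 by (subst ln_ge_iff) auto
      then have "real (\<xi> w) \<le> ln R / l" using assms by (simp add: field_simps)
      then show ?thesis using C(3) by linarith
    qed
    have "\<kappa> * real L \<le> (r/2)\<^sup>2 * l\<^sup>2 / (8 * max R 1) * real L"
      by (intro mult_right_mono) (auto simp: \<kappa>_def)
    also have "\<dots> \<le> real (card (busy L \<xi>))"
      by (rule card_busy_ge) (use assms L N R s in \<open>auto simp: pair_state_def\<close>)
    finally show "exp (-4) ^ C * ((\<kappa> / real C) ^ C * exp (-4) / 4) \<le> (pair_op L ^^ (C + 2)) met (\<xi>, x, y)"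
      using L \<kappa> C N s hC[OF R(1)] hC[OF R(2)]
      by (intro meet_from_bounded_heights) (auto simp: field_simps)
  qed
qed

section \<open>Geometric decay of the probability of being apart\<close>

text \<open>
  A Lyapunov function that contracts up to a constant, together with a uniform chance of absorption where
  this function is small, gives geometric decay of the probability of not being absorbed. The
  function \<open>of_bool (\<not> P s) * (1 + \<beta> * \<Psi> s)\<close> contracts strictly: for small \<open>\<Psi>\<close> by the chance of
  absorption, if \<open>\<beta>\<close> is small, and for large \<open>\<Psi>\<close> by the drift.
\<close>

lemma geometric_absorption:
  fixes k c :: nat and \<gamma> B R p :: real
  assumes "k \<ge> 1" "0 < \<gamma>" "\<gamma> < 1" "B \<ge> 0" "R > 0" "2 * B / (1 - \<gamma>)\<^sup>2 \<le> R" "p > 0"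
  obtains m :: nat and \<rho> \<beta> :: real where "m \<ge> 1" "0 < \<rho>" "\<rho> < 1" "\<beta> > 0"
    "\<And>(I :: 's \<Rightarrow> bool) \<Phi> P \<Psi> s n. markov_op I \<Phi> \<Longrightarrow> markov_op (\<lambda>s. I s \<and> P s) \<Phi> \<Longrightarrow>
      (\<And>s. I s \<Longrightarrow> \<Psi> s \<ge> 0) \<Longrightarrow> (\<And>s. I s \<Longrightarrow> (\<Phi> ^^ k) \<Psi> s \<le> \<gamma> * \<Psi> s + B) \<Longrightarrow>
      (\<And>s. I s \<Longrightarrow> \<Psi> s \<le> R \<Longrightarrow> p \<le> (\<Phi> ^^ c) (\<lambda>s. of_bool (P s)) s) \<Longrightarrow> I s \<Longrightarrow>
      (\<Phi> ^^ (m * n)) (\<lambda>s. of_bool (\<not> P s)) s \<le> \<rho> ^ n * (1 + \<beta> * \<Psi> s)"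
proof -
  define B3 where "B3 = B / (1 - \<gamma>)"
  have "2 * B \<le> R * (1 - \<gamma>)\<^sup>2" using assms by (simp add: pos_divide_le_eq)
  then have "B3 \<le> (1 - \<gamma>) / 2 * R"
    using assms by (simp add: B3_def pos_divide_le_eq power2_eq_square mult.commute mult.left_commute)
  then have B3: "B3 \<ge> 0" "B3 \<le> (1 - \<gamma>) / 2 * R"
    using assms by (auto simp: B3_def)
  define m where "m = k * Suc c"
  have "1 * c \<le> k * Suc c" by (rule mult_le_mono) (use assms in auto)
  then have m: "m \<ge> 1" "c \<le> m" using assms by (auto simp: m_def)
  define \<beta> where "\<beta> = p / (2 * (B3 + 1))"
  have \<beta>: "\<beta> > 0" "\<beta> * B3 \<le> p / 2" using assms B3 by (auto simp: \<beta>_def field_simps)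
  \<comment> \<open>For \<open>\<Psi> s > R\<close> the drift gains at least \<open>(1 - \<gamma>) / 2 * \<beta> * \<Psi> s\<close>, which is at least \<open>\<tau> * (1 + \<beta> * \<Psi> s)\<close>.\<close>
  define \<tau> where "\<tau> = min ((1 - \<gamma>) / 4) ((1 - \<gamma>) / 4 * (\<beta> * R))"
  have "\<tau> > 0" using assms \<beta> by (simp add: \<tau>_def)
  moreover have "\<tau> \<le> (1 - \<gamma>) / 4" unfolding \<tau>_def by (rule min.cobounded1)
  moreover have "\<tau> \<le> (1 - \<gamma>) / 4 * (\<beta> * R)" unfolding \<tau>_def by (rule min.cobounded2)
  ultimately have \<tau>: "\<tau> > 0" "\<tau> \<le> (1 - \<gamma>) / 4" "\<tau> \<le> (1 - \<gamma>) / 4 * (\<beta> * R)" by auto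
  define \<rho> where "\<rho> = max (max (1 - p / 2) \<gamma>) (1 - \<tau>)"
  have \<rho>: "0 < \<rho>" "\<rho> < 1" "1 - p / 2 \<le> \<rho>" "\<gamma> \<le> \<rho>" "1 - \<tau> \<le> \<rho>"
    using assms \<tau> by (auto simp: \<rho>_def)
  show ?thesis
  proof (rule that[of m \<rho> \<beta>])
    fix I :: "'s \<Rightarrow> bool" and \<Phi> P \<Psi> s n
    assume mk: "markov_op I \<Phi>" and mkP: "markov_op (\<lambda>s. I s \<and> P s) \<Phi>"
      and nonneg: "\<And>s. I s \<Longrightarrow> \<Psi> s \<ge> 0"
      and drift: "\<And>s. I s \<Longrightarrow> (\<Phi> ^^ k) \<Psi> s \<le> \<gamma> * \<Psi> s + B"
      and small: "\<And>s. I s \<Longrightarrow> \<Psi> s \<le> R \<Longrightarrow> p \<le> (\<Phi> ^^ c) (\<lambda>s. of_bool (P s)) s"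
      and s: "I s"
    note mkm = markov_op_funpow[OF mk, of m]
    define W where "W = (\<lambda>s. of_bool (\<not> P s) * (1 + \<beta> * \<Psi> s))"
    have contr: "(\<Phi> ^^ m) W s \<le> \<rho> * W s" if s: "I s" for s
    proof (cases "P s")
      case True
      have "(\<Phi> ^^ m) W s \<le> 0"
        by (rule markov_op_le_const[OF markov_op_funpow[OF mkP]]) (use s True in \<open>auto simp: W_def\<close>)
      then show ?thesis using True by (simp add: W_def)
    next
      case False
      have "(\<Phi> ^^ m) \<Psi> s = ((\<Phi> ^^ k) ^^ Suc c) \<Psi> s"
        by (simp only: m_def funpow_mult mult.commute)
      also have "\<dots> \<le> \<gamma> ^ Suc c * \<Psi> s + B3"
        unfolding B3_def
        by (rule markov_op_affine_iterate[OF markov_op_funpow[OF mk] drift]) (use assms s in auto)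
      also have "\<dots> \<le> \<gamma> * \<Psi> s + B3"
        using assms nonneg[OF s] power_decreasing[of 1 "Suc c" \<gamma>]
        by (intro add_right_mono mult_right_mono) auto
      finally have drift': "(\<Phi> ^^ m) \<Psi> s \<le> \<gamma> * \<Psi> s + B3" .
      have "(\<Phi> ^^ m) W s \<le> 1 * (\<Phi> ^^ m) (\<lambda>s. of_bool (\<not> P s)) s + \<beta> * (\<Phi> ^^ m) \<Psi> s + 0"
        by (rule markov_op_le_affine[OF mkm _ s]) (use nonneg \<beta> in \<open>auto simp: W_def\<close>)
      also have "\<dots> \<le> (\<Phi> ^^ m) (\<lambda>s. of_bool (\<not> P s)) s + \<beta> * (\<gamma> * \<Psi> s + B3)"
        using drift' \<beta> by simp
      finally have W1: "(\<Phi> ^^ m) W s \<le> (\<Phi> ^^ m) (\<lambda>s. of_bool (\<not> P s)) s + \<beta> * \<gamma> * \<Psi> s + \<beta> * B3"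
        by (simp add: algebra_simps)
      have bp: "\<beta> * \<Psi> s \<ge> 0" using nonneg[OF s] \<beta> by simp
      have "(\<Phi> ^^ m) W s \<le> \<rho> * (1 + \<beta> * \<Psi> s)"
      proof (cases "\<Psi> s \<le> R")
        case True
        have "(\<Phi> ^^ m) (\<lambda>s. of_bool (\<not> P s)) s \<le> (-1) * (\<Phi> ^^ m) (\<lambda>s. of_bool (P s)) s + 1"
          by (rule markov_op_le_affine1[OF mkm _ s]) auto
        also have "\<dots> \<le> 1 - p"
          using small[OF s True] absorbed_mono[OF mk mkP s m(2)] by linarith
        finally have "(\<Phi> ^^ m) W s \<le> (1 - p / 2) + \<gamma> * (\<beta> * \<Psi> s)"
          using W1 \<beta> by (simp add: algebra_simps)
        also have "\<dots> \<le> \<rho> + \<rho> * (\<beta> * \<Psi> s)"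
          using \<rho> bp by (intro add_mono mult_right_mono) auto
        finally show ?thesis by (simp add: algebra_simps)
      next
        case False
        have "(\<Phi> ^^ m) (\<lambda>s. of_bool (\<not> P s)) s \<le> 1"
          by (rule markov_op_le_const[OF mkm _ s]) auto
        moreover have "\<beta> * B3 \<le> (1 - \<gamma>) / 2 * (\<beta> * \<Psi> s)"
        proof -
          have "B3 \<le> (1 - \<gamma>) / 2 * \<Psi> s"
            using B3(2) False assms by (intro order_trans[OF B3(2)] mult_left_mono) auto
          from mult_left_mono[OF this, of \<beta>] \<beta> show ?thesis by (simp add: algebra_simps)
        qed
        moreover have "\<tau> + \<tau> * (\<beta> * \<Psi> s) \<le> (1 - \<gamma>) / 2 * (\<beta> * \<Psi> s)"
        proof -
          have "\<tau> \<le> (1 - \<gamma>) / 4 * (\<beta> * \<Psi> s)"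
            using False assms \<beta> by (intro order_trans[OF \<tau>(3)] mult_left_mono) auto
          moreover have "\<tau> * (\<beta> * \<Psi> s) \<le> (1 - \<gamma>) / 4 * (\<beta> * \<Psi> s)"
            by (rule mult_right_mono[OF \<tau>(2) bp])
          ultimately show ?thesis by (simp add: algebra_simps)
        qed
        ultimately have "(\<Phi> ^^ m) W s \<le> (1 - \<tau>) * (1 + \<beta> * \<Psi> s)"
          using W1 by (simp add: algebra_simps)
        also have "\<dots> \<le> \<rho> * (1 + \<beta> * \<Psi> s)" using \<rho> bp by (intro mult_right_mono) auto
        finally show ?thesis .
      qed
      then show ?thesis using False by (simp add: W_def)
    qed
    have "(\<Phi> ^^ (m * n)) (\<lambda>s. of_bool (\<not> P s)) s \<le> (\<Phi> ^^ (m * n)) W s"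
      by (rule markov_op_mono[OF markov_op_funpow[OF mk] _ s]) (use nonneg \<beta> in \<open>auto simp: W_def\<close>)
    also have "\<dots> = ((\<Phi> ^^ m) ^^ n) W s" by (simp only: funpow_mult mult.commute)
    also have "\<dots> \<le> \<rho> ^ n * W s"
      by (rule markov_op_geometric[OF mkm contr _ s]) (use \<rho> in auto)
    also have "\<dots> \<le> \<rho> ^ n * (1 + \<beta> * \<Psi> s)"
      using \<rho> nonneg[OF s] \<beta> by (intro mult_left_mono) (auto simp: W_def)
    finally show "(\<Phi> ^^ (m * n)) (\<lambda>s. of_bool (\<not> P s)) s \<le> \<rho> ^ n * (1 + \<beta> * \<Psi> s)" .
  qed (use m \<rho> \<beta> in auto)
qed

section \<open>The invariant law\<close>

lemma finite_rbb_configs: "finite (rbb_configs L N)"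
proof (rule finite_subset)
  show "rbb_configs L N \<subseteq> {f. \<forall>x. (x \<in> {1..L} \<longrightarrow> f x \<in> {..N}) \<and> (x \<notin> {1..L} \<longrightarrow> f x = 0)}"
  proof (intro subsetI CollectI allI conjI impI)
    fix f x assume f: "f \<in> rbb_configs L N" and x: "x \<in> {1..L}"
    have "f x \<le> (\<Sum>x=1..L. f x)" by (rule member_le_sum) (use x in auto)
    then show "f x \<in> {..N}" using f by (simp add: rbb_configs_def)
  qed (auto simp: rbb_configs_def)
  show "finite {f. \<forall>x. (x \<in> {1..L} \<longrightarrow> f x \<in> {..N}) \<and> (x \<notin> {1..L} \<longrightarrow> f x = (0::nat))}"
    by (rule finite_set_of_finite_funs) auto
qed

lemma rbb_invariant_finite: "rbb_invariant L N \<nu> \<Longrightarrow> finite (set_pmf \<nu>)"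
  unfolding rbb_invariant_def using finite_subset[OF _ finite_rbb_configs] by blast

lemma invariant_expectation:
  assumes "rbb_invariant L N \<nu>"
  shows "measure_pmf.expectation \<nu> ((rbb_op L ^^ t) f) = measure_pmf.expectation \<nu> f"
proof (induction t arbitrary: f)
  case (Suc t)
  have "measure_pmf.expectation \<nu> ((rbb_op L ^^ Suc t) f) = measure_pmf.expectation \<nu> ((rbb_op L ^^ t) (rbb_op L f))"
    by (simp add: funpow_swap1)
  also have "\<dots> = measure_pmf.expectation \<nu> (rbb_op L f)" by (rule Suc)
  also have "\<dots> = measure_pmf.expectation \<nu> (\<lambda>\<eta>. measure_pmf.expectation (rbb_law L \<eta> 1) f)"
    unfolding expectation_rbb_law by simp
  also have "\<dots> = measure_pmf.expectation (bind_pmf \<nu> (\<lambda>\<eta>. rbb_law L \<eta> 1)) f"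
    by (subst expectation_bind_finite) (auto simp: finite_rbb_law rbb_invariant_finite[OF assms])
  also have "\<dots> = measure_pmf.expectation \<nu> f"
    using assms by (simp add: rbb_invariant_def)
  finally show ?case .
qed simp

lemma invariant_expectation_mono:
  assumes "rbb_invariant L N \<nu>" "\<And>\<zeta>. \<zeta> \<in> rbb_configs L N \<Longrightarrow> f \<zeta> \<le> (h \<zeta> :: real)"
  shows "measure_pmf.expectation \<nu> f \<le> measure_pmf.expectation \<nu> h"
  by (rule integral_mono_AE)
     (use assms rbb_invariant_finite[OF assms(1)] in
       \<open>auto simp: AE_measure_pmf_iff rbb_invariant_def intro!: integrable_measure_pmf_finite\<close>)

text \<open>
  Integrating the drift inequality against an invariant law leaves the same expectation on both sides.
\<close>

lemma invariant_exp_moment: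
  assumes "rbb_invariant L N \<nu>" "\<gamma> < 1"
    "\<And>\<xi>. \<xi> \<in> rbb_configs L N \<Longrightarrow>
       (rbb_op L ^^ k) (\<lambda>\<xi>. exp (l * real (\<xi> z))) \<xi> \<le> \<gamma> * exp (l * real (\<xi> z)) + B"
  shows "measure_pmf.expectation \<nu> (\<lambda>\<zeta>. exp (l * real (\<zeta> z))) \<le> B / (1 - \<gamma>)"
proof -
  let ?f = "\<lambda>\<zeta>. exp (l * real (\<zeta> z))"
  have int [simp]: "integrable (measure_pmf \<nu>) (g :: _ \<Rightarrow> real)" for g
    by (rule integrable_measure_pmf_finite[OF rbb_invariant_finite[OF assms(1)]])
  have "measure_pmf.expectation \<nu> ?f = measure_pmf.expectation \<nu> ((rbb_op L ^^ k) ?f)"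
    by (rule invariant_expectation[OF assms(1), symmetric])
  also have "\<dots> \<le> measure_pmf.expectation \<nu> (\<lambda>\<zeta>. \<gamma> * ?f \<zeta> + B)"
    by (rule invariant_expectation_mono[OF assms(1,3)])
  also have "\<dots> = \<gamma> * measure_pmf.expectation \<nu> ?f + B" by simp
  finally have "(1 - \<gamma>) * measure_pmf.expectation \<nu> ?f \<le> B" by (simp add: algebra_simps)
  then show ?thesis using assms(2) by (simp add: pos_le_divide_eq mult.commute)
qed

section \<open>Uniform decay for adjacent configurations\<close>

lemma pair_weight_nonneg: "A \<ge> 0 \<Longrightarrow> 0 \<le> pair_weight l A L s"
  by (auto simp: pair_weight_def mean_exp_nonneg split: prod.splits)

lemma pair_weight_le_sum:
  assumes "A \<ge> 0" "x \<in> {1..L}" "y \<in> {1..L}"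
  shows "pair_weight l A L (\<xi>, x, y) \<le> (2 + A) * (\<Sum>z=1..L. exp (l * real (\<xi> z)))"
proof -
  let ?S = "\<Sum>z=1..L. exp (l * real (\<xi> z))"
  have S: "exp (l * real (\<xi> w)) \<le> ?S" if "w \<in> {1..L}" for w
    by (rule member_le_sum) (use that in auto)
  have "0 \<le> ?S" by (intro sum_nonneg) simp
  then have "mean_exp l L \<xi> \<le> ?S"
    using assms(2) mult_right_mono[of 1 "real L" ?S] by (simp add: mean_exp_def divide_le_eq mult.commute)
  then have "A * mean_exp l L \<xi> \<le> A * ?S" using assms(1) by (rule mult_left_mono)
  then show ?thesis
    using S[OF assms(2)] S[OF assms(3)] by (simp add: pair_weight_def algebra_simps)
qed

text \<open>
  All constants depend on \<open>r\<close> alone. The background carries one ball less than the process, hence the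
  window for its density. The same exponent \<open>l\<close> serves for the invariant law, which later absorbs the
  factor that depends on the second initial configuration.
\<close>

lemma apart_decay:
  fixes r :: real
  assumes "r > 0"
  obtains m :: nat and l \<rho> Q D L0 :: real where "m \<ge> 1" "l > 0" "0 < \<rho>" "\<rho> < 1" "Q > 0" "D \<ge> 0"
    "\<And>L N \<xi> x y n. real L \<ge> L0 \<Longrightarrow> L \<ge> 4 \<Longrightarrow> pair_state L N (\<xi>, x, y) \<Longrightarrow>
       r / 2 * real L \<le> real N \<Longrightarrow> real N \<le> r * real L \<Longrightarrow>
       (pair_op L ^^ (m * n)) (\<lambda>(\<xi>, x, y). of_bool (x \<noteq> y)) (\<xi>, x, y)
         \<le> \<rho> ^ n * (Q * (\<Sum>z=1..L. exp (l * real (\<xi> z))))"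
    "\<And>L N \<nu> z. L \<ge> 4 \<Longrightarrow> real N \<le> r * real L \<Longrightarrow> rbb_invariant L N \<nu> \<Longrightarrow> z \<in> {1..L} \<Longrightarrow>
       measure_pmf.expectation \<nu> (\<lambda>\<zeta>. exp (l * real (\<zeta> z))) \<le> D"
proof -
  obtain k l \<gamma> B where k: "k \<ge> 1" "l > 0" "0 < \<gamma>" "\<gamma> < 1" "B \<ge> 0" and
    drift: "\<And>L N \<xi> z. L \<ge> 4 \<Longrightarrow> \<xi> \<in> rbb_configs L N \<Longrightarrow> real N \<le> r * real L \<Longrightarrow> z \<in> {1..L} \<Longrightarrow>
       (rbb_op L ^^ k) (\<lambda>\<xi>. exp (l * real (\<xi> z))) \<xi> \<le> \<gamma> * exp (l * real (\<xi> z)) + B"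
    using exp_moment_block_drift[OF assms] by blast
  obtain A \<gamma>' B' where A: "A > 0" "0 < \<gamma>'" "\<gamma>' < 1" "B' \<ge> 0" and
    weight: "\<And>L N s. pair_state L N s \<Longrightarrow>
      (\<And>\<xi> z. \<xi> \<in> rbb_configs L N \<Longrightarrow> z \<in> {1..L} \<Longrightarrow>
         (rbb_op L ^^ k) (\<lambda>\<xi>. exp (l * real (\<xi> z))) \<xi> \<le> \<gamma> * exp (l * real (\<xi> z)) + B) \<Longrightarrow>
      (pair_op L ^^ k) (pair_weight l A L) s \<le> \<gamma>' * pair_weight l A L s + B'"
    using pair_weight_drift[OF k] by blast
  define R where "R = 2 * B' / (1 - \<gamma>')\<^sup>2 + 1"
  have R: "R > 0" "2 * B' / (1 - \<gamma>')\<^sup>2 \<le> R" using A by (auto simp: R_def intro!: add_nonneg_pos)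
  obtain C p L0 where p: "p > 0" and
    small: "\<And>L N \<xi> x y. real L \<ge> L0 \<Longrightarrow> L \<ge> 4 \<Longrightarrow> pair_state L N (\<xi>, x, y) \<Longrightarrow>
       r / 2 * real L \<le> real N \<Longrightarrow> real N \<le> r * real L \<Longrightarrow>
       exp (l * real (\<xi> x)) \<le> max R (R / A) \<Longrightarrow> exp (l * real (\<xi> y)) \<le> max R (R / A) \<Longrightarrow>
       mean_exp l L \<xi> \<le> max R (R / A) \<Longrightarrow> p \<le> (pair_op L ^^ C) met (\<xi>, x, y)"
  proof (rule small_set_meeting[OF assms k(2), where R = "max R (R / A)"])
    fix C p L0
    assume "p > 0" and "\<And>L N \<xi> x y. real L \<ge> L0 \<Longrightarrow> L \<ge> 4 \<Longrightarrow> pair_state L N (\<xi>, x, y) \<Longrightarrow>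
       r / 2 * real L \<le> real N \<Longrightarrow> real N \<le> r * real L \<Longrightarrow>
       exp (l * real (\<xi> x)) \<le> max R (R / A) \<Longrightarrow> exp (l * real (\<xi> y)) \<le> max R (R / A) \<Longrightarrow>
       mean_exp l L \<xi> \<le> max R (R / A) \<Longrightarrow> p \<le> (pair_op L ^^ C) met (\<xi>, x, y)"
    from that[OF this] show thesis .
  qed
  obtain m \<rho> \<beta> where m: "m \<ge> 1" "0 < \<rho>" "\<rho> < 1" "\<beta> > 0" and
    absorb: "\<And>(I :: (nat \<Rightarrow> nat) \<times> nat \<times> nat \<Rightarrow> bool) \<Phi> P \<Psi> s n. markov_op I \<Phi> \<Longrightarrow> markov_op (\<lambda>s. I s \<and> P s) \<Phi> \<Longrightarrow>
      (\<And>s. I s \<Longrightarrow> \<Psi> s \<ge> 0) \<Longrightarrow> (\<And>s. I s \<Longrightarrow> (\<Phi> ^^ k) \<Psi> s \<le> \<gamma>' * \<Psi> s + B') \<Longrightarrow>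
      (\<And>s. I s \<Longrightarrow> \<Psi> s \<le> R \<Longrightarrow> p \<le> (\<Phi> ^^ C) (\<lambda>s. of_bool (P s)) s) \<Longrightarrow> I s \<Longrightarrow>
      (\<Phi> ^^ (m * n)) (\<lambda>s. of_bool (\<not> P s)) s \<le> \<rho> ^ n * (1 + \<beta> * \<Psi> s)"
  proof (rule geometric_absorption[OF k(1) A(2,3,4) R p, where c = C])
    fix m :: nat and \<rho> \<beta> :: real
    assume *: "m \<ge> 1" "0 < \<rho>" "\<rho> < 1" "\<beta> > 0" "\<And>(I :: (nat \<Rightarrow> nat) \<times> nat \<times> nat \<Rightarrow> bool) \<Phi> P \<Psi> s n. markov_op I \<Phi> \<Longrightarrow> markov_op (\<lambda>s. I s \<and> P s) \<Phi> \<Longrightarrow>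
      (\<And>s. I s \<Longrightarrow> \<Psi> s \<ge> 0) \<Longrightarrow> (\<And>s. I s \<Longrightarrow> (\<Phi> ^^ k) \<Psi> s \<le> \<gamma>' * \<Psi> s + B') \<Longrightarrow>
      (\<And>s. I s \<Longrightarrow> \<Psi> s \<le> R \<Longrightarrow> p \<le> (\<Phi> ^^ C) (\<lambda>s. of_bool (P s)) s) \<Longrightarrow> I s \<Longrightarrow>
      (\<Phi> ^^ (m * n)) (\<lambda>s. of_bool (\<not> P s)) s \<le> \<rho> ^ n * (1 + \<beta> * \<Psi> s)"
    show thesis by (rule that[of m \<rho> \<beta>, OF *(1-4)]) (rule *(5))
  qed
  show ?thesis
  proof (rule that[of m l \<rho> "1 + \<beta> * (2 + A)" "B / (1 - \<gamma>)" L0])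
    fix L N \<xi> x y n
    assume L: "real L \<ge> L0" "L \<ge> 4" and s: "pair_state L N (\<xi>, x, y)" and N: "r / 2 * real L \<le> real N" "real N \<le> r * real L"
    have xy: "x \<in> {1..L}" "y \<in> {1..L}" using s by (auto simp: pair_state_def)
    have bounded: "p \<le> (pair_op L ^^ C) met s" if st: "pair_state L N s" and w: "pair_weight l A L s \<le> R" for s
    proof (cases s)
      case (fields \<zeta> a b)
      have w': "exp (l * real (\<zeta> a)) + exp (l * real (\<zeta> b)) + A * mean_exp l L \<zeta> \<le> R"
        using w by (simp add: fields pair_weight_def)
      have "0 \<le> A * mean_exp l L \<zeta>" "0 \<le> exp (l * real (\<zeta> a))" "0 \<le> exp (l * real (\<zeta> b))"
        using A by (auto simp: mean_exp_nonneg)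
      with w' have e: "exp (l * real (\<zeta> a)) \<le> R" "exp (l * real (\<zeta> b)) \<le> R" "A * mean_exp l L \<zeta> \<le> R"
        by linarith+
      from e(3) have "mean_exp l L \<zeta> \<le> R / A" using A by (simp add: pos_le_divide_eq mult.commute)
      with e show ?thesis unfolding fields
        using st by (intro small[OF L _ N]) (auto simp: fields)
    qed
    let ?S = "\<Sum>z=1..L. exp (l * real (\<xi> z))"
    have S1: "1 \<le> ?S"
    proof -
      have "1 \<le> exp (l * real (\<xi> x))" using k(2) by simp
      also have "\<dots> \<le> ?S" by (rule member_le_sum) (use xy in auto)
      finally show ?thesis .
    qed
    have "(pair_op L ^^ (m * n)) (\<lambda>s. of_bool (\<not> fst (snd s) = snd (snd s))) (\<xi>, x, y) \<le> \<rho> ^ n * (1 + \<beta> * pair_weight l A L (\<xi>, x, y))"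
    proof (rule absorb[OF markov_op_pair[of L N] markov_op_pair_met _ _ bounded s])
      fix s assume st: "pair_state L N s"
      show "0 \<le> pair_weight l A L s" using A by (intro pair_weight_nonneg) simp
      show "(pair_op L ^^ k) (pair_weight l A L) s \<le> \<gamma>' * pair_weight l A L s + B'"
        by (rule weight[OF st]) (rule drift[OF L(2) _ N(2)])
    qed
    also have "\<dots> \<le> \<rho> ^ n * (1 * ?S + \<beta> * ((2 + A) * ?S))"
      using m A pair_weight_le_sum[OF _ xy, of A l \<xi>] S1
      by (intro mult_left_mono add_mono) auto
    also have "\<dots> = \<rho> ^ n * ((1 + \<beta> * (2 + A)) * ?S)" by (simp add: algebra_simps)
    finally show "(pair_op L ^^ (m * n)) (\<lambda>(\<xi>, x, y). of_bool (x \<noteq> y)) (\<xi>, x, y)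
         \<le> \<rho> ^ n * ((1 + \<beta> * (2 + A)) * ?S)" by (simp add: case_prod_beta')
  next
    fix L N \<nu> z
    assume "L \<ge> 4" "real N \<le> r * real L" "rbb_invariant L N \<nu>" "z \<in> {1..L}"
    then show "measure_pmf.expectation \<nu> (\<lambda>\<zeta>. exp (l * real (\<zeta> z))) \<le> B / (1 - \<gamma>)"
      using drift k by (intro invariant_exp_moment) auto
  qed (use m k A in \<open>auto intro!: add_pos_pos\<close>)
qed

section \<open>Moving one ball at a time\<close>

lemma add_ball_sum: "x \<in> {1..L} \<Longrightarrow> (\<Sum>z=1..L. add_ball \<xi> x z) = Suc (\<Sum>z=1..L. \<xi> z)"
proof -
  assume x: "x \<in> {1..L}"
  have "(\<Sum>z=1..L. add_ball \<xi> x z) = (\<Sum>z=1..L. \<xi> z + (if z = x then 1 else 0))"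
    by (rule sum.cong) (auto simp: add_ball_def)
  then show ?thesis using x by (simp add: sum.distrib)
qed

text \<open>
  Move a surplus ball of \<open>\<eta>\<close> to a site where \<open>\<eta>\<close> has fewer balls than \<open>\<zeta>\<close>, and repeat. All intermediate
  configurations stay below any common bound \<open>b\<close> of \<open>\<eta>\<close> and \<open>\<zeta>\<close>, so their exponential weights are
  controlled by those of the end points.
\<close>

lemma path_diff_le:
  fixes G :: "(nat \<Rightarrow> nat) \<Rightarrow> real" and b :: "nat \<Rightarrow> nat"
  assumes adj: "\<And>\<xi> x y. pair_state L (N - 1) (\<xi>, x, y) \<Longrightarrow> (\<And>z. \<xi> z \<le> b z) \<Longrightarrow>
      \<bar>G (add_ball \<xi> x) - G (add_ball \<xi> y)\<bar> \<le> K"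
    and "\<zeta> \<in> rbb_configs L N" "\<And>z. \<zeta> z \<le> b z" "\<eta> \<in> rbb_configs L N" "\<And>z. \<eta> z \<le> b z"
  shows "\<bar>G \<eta> - G \<zeta>\<bar> \<le> real (\<Sum>z=1..L. \<eta> z - \<zeta> z) * K"
  using assms(4,5)
proof (induction "\<Sum>z=1..L. \<eta> z - \<zeta> z" arbitrary: \<eta>)
  case 0
  have le: "\<eta> z \<le> \<zeta> z" if "z \<in> {1..L}" for z using 0 that by simp
  have "\<eta> z = \<zeta> z" for z
  proof (cases "z \<in> {1..L}")
    case True
    have "(\<Sum>z=1..L. \<eta> z) = (\<Sum>z=1..L. \<zeta> z)" using 0 assms(2) by (simp add: rbb_configs_def)
    then show ?thesis using sum_mono_inv[of \<eta> "{1..L}" \<zeta> z] le True by auto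
  next
    case False
    then show ?thesis using 0 assms(2) by (simp add: rbb_configs_def)
  qed
  then have "\<eta> = \<zeta>" by (rule ext)
  then show ?case by simp
next
  case (Suc d)
  have sums: "(\<Sum>z=1..L. \<eta> z) = N" "(\<Sum>z=1..L. \<zeta> z) = N"
    using Suc.prems(1) assms(2) by (auto simp: rbb_configs_def)
  obtain x where x: "x \<in> {1..L}" "\<zeta> x < \<eta> x"
  proof -
    have "\<exists>x\<in>{1..L}. \<eta> x - \<zeta> x \<noteq> 0"
    proof (rule ccontr)
      assume "\<not> ?thesis"
      then have "(\<Sum>z=1..L. \<eta> z - \<zeta> z) = 0" by simp
      then show False using Suc.hyps(2) by simp
    qed
    then show ?thesis using that by auto
  qed
  obtain y where y: "y \<in> {1..L}" "\<eta> y < \<zeta> y"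
  proof -
    have "\<exists>y\<in>{1..L}. \<eta> y < \<zeta> y"
    proof (rule ccontr)
      assume *: "\<not> ?thesis"
      have "(\<Sum>z=1..L. \<zeta> z) < (\<Sum>z=1..L. \<eta> z)"
        by (rule sum_strict_mono_ex1) (use * x in \<open>auto simp: not_less\<close>)
      then show False using sums by simp
    qed
    then show ?thesis using that by auto
  qed
  have xy: "x \<noteq> y" using x y by auto
  define \<xi> where "\<xi> = \<eta>(x := \<eta> x - 1)"
  have \<eta>: "\<eta> = add_ball \<xi> x" using x by (auto simp: \<xi>_def add_ball_def)
  define \<eta>' where "\<eta>' = add_ball \<xi> y"
  have \<xi>: "\<xi> \<in> rbb_configs L (N - 1)" "N = Suc (\<Sum>z=1..L. \<xi> z)"
    using sums(1) add_ball_sum[OF x(1), of \<xi>] Suc.prems(1) x(1)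
    unfolding \<eta>[symmetric] by (auto simp: rbb_configs_def \<xi>_def)
  have "\<bar>G \<eta> - G \<eta>'\<bar> \<le> K"
    unfolding \<eta>'_def by (subst \<eta>, rule adj)
      (use \<xi> x y Suc.prems(2) in \<open>auto simp: pair_state_def \<xi>_def intro: le_trans[OF diff_le_self]\<close>)
  moreover have "\<bar>G \<eta>' - G \<zeta>\<bar> \<le> real (\<Sum>z=1..L. \<eta>' z - \<zeta> z) * K"
  proof (rule Suc.hyps(1))
    have "(\<Sum>z=1..L. \<eta> z - \<zeta> z) = (\<Sum>z=1..L. (\<eta>' z - \<zeta> z) + (if z = x then 1 else 0))"
      by (rule sum.cong) (use x y xy in \<open>auto simp: \<eta>'_def \<xi>_def add_ball_def\<close>)
    then show d: "d = (\<Sum>z=1..L. \<eta>' z - \<zeta> z)" using x Suc.hyps(2) by (simp add: sum.distrib)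
    show "\<eta>' \<in> rbb_configs L N"
      using \<xi> y add_ball_sum[OF y(1), of \<xi>] by (auto simp: rbb_configs_def \<eta>'_def add_ball_def)
    show "\<eta>' z \<le> b z" for z
      using Suc.prems(2)[of z] assms(3)[of z] y xy by (auto simp: \<eta>'_def \<xi>_def add_ball_def)
  qed
  moreover have "(\<Sum>z=1..L. \<eta> z - \<zeta> z) = Suc (\<Sum>z=1..L. \<eta>' z - \<zeta> z)"
  proof -
    have "(\<Sum>z=1..L. \<eta> z - \<zeta> z) = (\<Sum>z=1..L. (\<eta>' z - \<zeta> z) + (if z = x then 1 else 0))"
      by (rule sum.cong) (use x y xy in \<open>auto simp: \<eta>'_def \<xi>_def add_ball_def\<close>)
    then show ?thesis using x by (simp add: sum.distrib)
  qed
  ultimately show ?case by (simp add: algebra_simps del: of_nat_sum)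
qed

section \<open>Total variation and mixing time\<close>

text \<open>
  The second initial configuration is drawn from the invariant law, whose exponential moments are
  bounded, so only the first one contributes an exponential of its maximum. One power of \<open>L\<close> comes from
  the number of single-ball moves, the other one from the sum over the sites.
\<close>

lemma tv_dist_decay:
  fixes r :: real
  assumes "r > 0"
  obtains m :: nat and l \<rho> Q L0 :: real where "m \<ge> 1" "l > 0" "0 < \<rho>" "\<rho> < 1" "Q > 0"
    "\<And>L N \<eta> \<nu> n. real L \<ge> L0 \<Longrightarrow> r * real L = real N \<Longrightarrow> \<eta> \<in> rbb_configs L N \<Longrightarrow> rbb_invariant L N \<nu> \<Longrightarrow>
       tv_dist (rbb_law L \<eta> (m * n)) \<nu> \<le> Q * (real L)\<^sup>2 * \<rho> ^ n * exp (l * real (max_occupancy L \<eta>))"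
proof -
  obtain m l \<rho> Q D L0 where m: "m \<ge> 1" "l > 0" "0 < \<rho>" "\<rho> < 1" "Q > 0" "D \<ge> 0" and
    decay: "\<And>L N \<xi> x y n. real L \<ge> L0 \<Longrightarrow> L \<ge> 4 \<Longrightarrow> pair_state L N (\<xi>, x, y) \<Longrightarrow>
       r / 2 * real L \<le> real N \<Longrightarrow> real N \<le> r * real L \<Longrightarrow>
       (pair_op L ^^ (m * n)) (\<lambda>(\<xi>, x, y). of_bool (x \<noteq> y)) (\<xi>, x, y)
         \<le> \<rho> ^ n * (Q * (\<Sum>z=1..L. exp (l * real (\<xi> z))))" and
    moment: "\<And>L N \<nu> z. L \<ge> 4 \<Longrightarrow> real N \<le> r * real L \<Longrightarrow> rbb_invariant L N \<nu> \<Longrightarrow> z \<in> {1..L} \<Longrightarrow>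
       measure_pmf.expectation \<nu> (\<lambda>\<zeta>. exp (l * real (\<zeta> z))) \<le> D"
    using apart_decay[OF assms] by blast
  \<comment> \<open>For \<open>L \<ge> 2 / r\<close> the background still has density at least \<open>r / 2\<close>.\<close>
  show ?thesis
  proof (rule that[of m l \<rho> "r * Q * (1 + D)" "max L0 (max 4 (2 / r))"])
    fix L N \<eta> \<nu> n
    assume L: "max L0 (max 4 (2 / r)) \<le> real L" and N: "r * real L = real N"
      and \<eta>: "\<eta> \<in> rbb_configs L N" and \<nu>: "rbb_invariant L N \<nu>"
    have L4: "L0 \<le> real L" "L \<ge> 4" using L by auto
    have rL: "r * real L \<ge> 2" using L assms by (simp add: divide_le_eq mult.commute)
    have N1: "r / 2 * real L \<le> real (N - 1)" "real (N - 1) \<le> r * real L" "real N \<le> r * real L"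
      using rL N by auto
    have int [simp]: "integrable (measure_pmf \<nu>) (g :: _ \<Rightarrow> real)" for g
      by (rule integrable_measure_pmf_finite[OF rbb_invariant_finite[OF \<nu>]])
    define E where "E = (\<lambda>\<zeta>::nat\<Rightarrow>nat. \<Sum>z=1..L. exp (l * real (\<zeta> z)))"
    define h where "h = max_occupancy L \<eta>"
    have Eh: "E \<eta> \<le> real L * exp (l * real h)"
    proof -
      have "\<eta> z \<le> h" if "z \<in> {1..L}" for z
        unfolding h_def max_occupancy_def by (rule Max_ge) (use that in auto)
      then have "E \<eta> \<le> (\<Sum>z=1..L. exp (l * real h))"
        unfolding E_def using m(2) by (intro sum_mono) auto
      then show ?thesis by simp
    qed
    have eh: "1 \<le> exp (l * real h)" using m(2) by simp
    have E\<nu>: "measure_pmf.expectation \<nu> E \<le> real L * D"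
    proof -
      have "measure_pmf.expectation \<nu> E = (\<Sum>z=1..L. measure_pmf.expectation \<nu> (\<lambda>\<zeta>. exp (l * real (\<zeta> z))))"
        unfolding E_def by (rule Bochner_Integration.integral_sum) simp
      also have "\<dots> \<le> (\<Sum>z=1..L. D)" by (intro sum_mono moment[OF L4(2) N1(3) \<nu>])
      finally show ?thesis by simp
    qed
    define \<delta> where "\<delta> = real N * \<rho> ^ n * Q"
    have \<delta>: "\<delta> \<ge> 0" using m by (simp add: \<delta>_def)
    have pair: "\<bar>(rbb_op L ^^ (m * n)) f \<eta> - (rbb_op L ^^ (m * n)) f \<zeta>\<bar> \<le> \<delta> * (E \<eta> + E \<zeta>)"
      if f: "\<And>\<eta>. 0 \<le> f \<eta>" "\<And>\<eta>. f \<eta> \<le> 1" and \<zeta>: "\<zeta> \<in> rbb_configs L N" for f \<zeta>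
    proof -
      define K where "K = \<rho> ^ n * (Q * (E \<eta> + E \<zeta>))"
      have "0 \<le> E \<eta>" "0 \<le> E \<zeta>" unfolding E_def by (auto intro!: sum_nonneg)
      then have K: "K \<ge> 0" using m by (simp add: K_def)
      have "\<bar>(rbb_op L ^^ (m * n)) f \<eta> - (rbb_op L ^^ (m * n)) f \<zeta>\<bar> \<le> real (\<Sum>z=1..L. \<eta> z - \<zeta> z) * K"
      proof (rule path_diff_le[where b = "\<lambda>z. max (\<eta> z) (\<zeta> z)", OF _ \<zeta> _ \<eta>])
        fix \<xi> x y
        assume s: "pair_state L (N - 1) (\<xi>, x, y)" and le: "\<And>z. \<xi> z \<le> max (\<eta> z) (\<zeta> z)"
        have "\<bar>(rbb_op L ^^ (m * n)) f (add_ball \<xi> x) - (rbb_op L ^^ (m * n)) f (add_ball \<xi> y)\<bar>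
           \<le> \<rho> ^ n * (Q * E \<xi>)"
          unfolding E_def
          by (rule order_trans[OF adjacent_diff_le[OF s f] decay[OF L4 s N1(1,2)]])
        also have "E \<xi> \<le> E \<eta> + E \<zeta>"
          unfolding E_def sum.distrib[symmetric]
        proof (rule sum_mono)
          fix z
          have "l * real (\<xi> z) \<le> l * real (\<eta> z) \<or> l * real (\<xi> z) \<le> l * real (\<zeta> z)"
            using le[of z] m(2) by (auto simp: le_max_iff_disj)
          then show "exp (l * real (\<xi> z)) \<le> exp (l * real (\<eta> z)) + exp (l * real (\<zeta> z))"
            by (auto intro: add_increasing add_increasing2)
        qed
        then have "\<rho> ^ n * (Q * E \<xi>) \<le> K"
          unfolding K_def using m by (intro mult_left_mono) auto
        finally show "\<bar>(rbb_op L ^^ (m * n)) f (add_ball \<xi> x) - (rbb_op L ^^ (m * n)) f (add_ball \<xi> y)\<bar> \<le> K" .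
      qed auto
      also have "\<dots> \<le> real N * K"
      proof (rule mult_right_mono[OF _ K])
        have "(\<Sum>z=1..L. \<eta> z - \<zeta> z) \<le> (\<Sum>z=1..L. \<eta> z)" by (rule sum_mono) simp
        then show "real (\<Sum>z=1..L. \<eta> z - \<zeta> z) \<le> real N"
          using \<eta> by (simp add: rbb_configs_def del: of_nat_sum)
      qed
      finally show ?thesis by (simp add: K_def \<delta>_def mult.assoc)
    qed
    show "tv_dist (rbb_law L \<eta> (m * n)) \<nu> \<le> r * Q * (1 + D) * (real L)\<^sup>2 * \<rho> ^ n * exp (l * real (max_occupancy L \<eta>))"
      unfolding tv_dist_def
    proof (rule cSUP_least)
      fix A :: "(nat \<Rightarrow> nat) set"
      let ?f = "indicat_real A"
      define g where "g = (rbb_op L ^^ (m * n)) ?f"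
      have 1: "measure_pmf.prob (rbb_law L \<eta> (m * n)) A = g \<eta>"
        using expectation_rbb_law[of L \<eta> "m * n" ?f] by (simp add: g_def)
      have 2: "measure_pmf.prob \<nu> A = measure_pmf.expectation \<nu> g"
        using invariant_expectation[OF \<nu>, of "m * n" ?f] by (simp add: g_def)
      have "\<bar>g \<eta> - measure_pmf.expectation \<nu> g\<bar> = \<bar>measure_pmf.expectation \<nu> (\<lambda>\<zeta>. g \<eta> - g \<zeta>)\<bar>"
        by simp
      also have "\<dots> \<le> measure_pmf.expectation \<nu> (\<lambda>\<zeta>. \<bar>g \<eta> - g \<zeta>\<bar>)"
        by (rule integral_abs_bound)
      also have "\<dots> \<le> measure_pmf.expectation \<nu> (\<lambda>\<zeta>. \<delta> * (E \<eta> + E \<zeta>))"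
        by (rule invariant_expectation_mono[OF \<nu>]) (unfold g_def, rule pair, auto)
      also have "\<dots> = \<delta> * (E \<eta> + measure_pmf.expectation \<nu> E)" by simp
      also have "\<dots> \<le> \<delta> * (real L * exp (l * real h) + real L * D * exp (l * real h))"
      proof (rule mult_left_mono[OF add_mono[OF Eh] \<delta>])
        have "real L * D * 1 \<le> real L * D * exp (l * real h)"
          using m by (intro mult_left_mono eh) auto
        with E\<nu> show "measure_pmf.expectation \<nu> E \<le> real L * D * exp (l * real h)" by simp
      qed
      also have "\<dots> = r * Q * (1 + D) * (real L)\<^sup>2 * \<rho> ^ n * exp (l * real h)"
        unfolding \<delta>_def N[symmetric] by (simp add: power2_eq_square algebra_simps)
      finally show "\<bar>measure_pmf.prob (rbb_law L \<eta> (m * n)) A - measure_pmf.prob \<nu> A\<bar> \<le>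
          r * Q * (1 + D) * (real L)\<^sup>2 * \<rho> ^ n * exp (l * real (max_occupancy L \<eta>))"
        unfolding 1 2 h_def .
    qed simp
  qed (use m assms in auto)
qed

lemma rbb_tmix_le:
  assumes "tv_dist (rbb_law L \<eta> t) \<nu> < \<epsilon>"
  shows "ereal_of_enat (rbb_tmix L \<nu> \<eta> \<epsilon>) \<le> ereal (real t)"
proof -
  have "rbb_tmix L \<nu> \<eta> \<epsilon> \<le> enat t"
    unfolding rbb_tmix_def by (rule INF_lower) (use assms in simp)
  then have "ereal_of_enat (rbb_tmix L \<nu> \<eta> \<epsilon>) \<le> ereal_of_enat (enat t)"
    by (simp only: ereal_of_enat_le_iff)
  then show ?thesis by simp
qed

theorem theorem2p1:
  fixes r :: real
  assumes "r > 0"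
  shows "\<exists>c::real. c > 0 \<and>
    (\<forall>(\<epsilon>::real) (L::nat) (N::nat) (\<eta>::nat \<Rightarrow> nat) (\<nu>::(nat \<Rightarrow> nat) pmf).
       0 < \<epsilon> \<and> \<epsilon> < 1/2 \<and> L \<ge> 1 \<and> r * real L = real N \<and> real L \<ge> c / \<epsilon> \<and>
       \<eta> \<in> rbb_configs L N \<and> rbb_invariant L N \<nu> \<longrightarrow>
         ereal_of_enat (rbb_tmix L \<nu> \<eta> \<epsilon>)
           \<le> ereal (c * (real (max_occupancy L \<eta>) + ln (real L) powr c)))"
proof -
  obtain m l \<rho> Q L0 where m: "m \<ge> 1" "l > 0" "0 < \<rho>" "\<rho> < 1" "Q > 0" and
    decay: "\<And>L N \<eta> \<nu> n. real L \<ge> L0 \<Longrightarrow> r * real L = real N \<Longrightarrow> \<eta> \<in> rbb_configs L N \<Longrightarrow> rbb_invariant L N \<nu> \<Longrightarrow>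
       tv_dist (rbb_law L \<eta> (m * n)) \<nu> \<le> Q * (real L)\<^sup>2 * \<rho> ^ n * exp (l * real (max_occupancy L \<eta>))"
    using tv_dist_decay[OF assms] by blast
  define \<kappa> where "\<kappa> = - ln \<rho>"
  have \<kappa>: "\<kappa> > 0" using m by (simp add: \<kappa>_def)
  define c where "c = max (max 4 L0) (max Q (max (real m * l / \<kappa>) (real m * (4 / \<kappa> + 1))))"
  have c: "c \<ge> 4" "L0 \<le> c" "Q \<le> c" "real m * l / \<kappa> \<le> c" "real m * (4 / \<kappa> + 1) \<le> c"
    by (auto simp: c_def)
  show ?thesis
  proof (intro exI[of _ c] conjI allI impI)
    show "c > 0" using c by simp
    fix \<epsilon> :: real and L N :: nat and \<eta> \<nu>
    assume *: "0 < \<epsilon> \<and> \<epsilon> < 1/2 \<and> L \<ge> 1 \<and> r * real L = real N \<and> real L \<ge> c / \<epsilon> \<and>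
       \<eta> \<in> rbb_configs L N \<and> rbb_invariant L N \<nu>"
    then have \<epsilon>: "0 < \<epsilon>" "\<epsilon> < 1/2" and cL: "c \<le> \<epsilon> * real L"
      by (auto simp: divide_le_eq mult.commute)
    have "\<epsilon> * real L \<le> 1 * real L" using \<epsilon> by (intro mult_right_mono) auto
    then have L: "c \<le> real L" using cL by simp
    have Lpos: "real L > 0" using L c by linarith
    have ln1: "ln (real L) \<ge> 1"
    proof -
      have "exp 1 \<le> real L" using exp_le L c by linarith
      then show ?thesis using Lpos by (subst ln_ge_iff) auto
    qed
    define h where "h = real (max_occupancy L \<eta>)"
    have h: "h \<ge> 0" by (simp add: h_def)
    \<comment> \<open>After this many blocks the exponential of the maximum is cancelled and a factor \<open>1 / L\<^sup>4\<close> is left;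
      two of its powers compensate \<open>L\<^sup>2\<close>, and one more the constant \<open>Q \<le> L\<close>.\<close>
    define a where "a = (l * h + 4 * ln (real L)) / \<kappa>"
    have a: "a \<ge> 0" using h m \<kappa> ln1 by (simp add: a_def)
    define n where "n = nat \<lceil>a\<rceil>"
    have n: "a \<le> real n" "real n \<le> a + 1" using a unfolding n_def by linarith+
    have "tv_dist (rbb_law L \<eta> (m * n)) \<nu> \<le> Q * (real L)\<^sup>2 * \<rho> ^ n * exp (l * h)"
      unfolding h_def using * L c by (intro decay) auto
    also have "\<rho> ^ n \<le> exp (- (l * h)) * (1 / real L ^ 4)"
    proof -
      have "\<rho> ^ n = exp (real n * ln \<rho>)" using m(3) by (simp add: exp_of_nat_mult)
      also have "real n * ln \<rho> \<le> - (l * h + 4 * ln (real L))"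
      proof -
        have "l * h + 4 * ln (real L) = a * \<kappa>" using \<kappa> by (simp add: a_def)
        also have "\<dots> \<le> real n * \<kappa>" using n \<kappa> by (intro mult_right_mono) auto
        finally show ?thesis by (simp add: \<kappa>_def)
      qed
      then have "exp (real n * ln \<rho>) \<le> exp (- (l * h) + - (4 * ln (real L)))" by simp
      also have "\<dots> = exp (- (l * h)) * (1 / real L ^ 4)"
      proof -
        have "exp (4 * ln (real L)) = real L ^ 4"
          using exp_of_nat_mult[of 4 "ln (real L)"] Lpos by simp
        then show ?thesis by (simp only: exp_add exp_minus[of "4 * ln (real L)"] inverse_eq_divide)
      qed
      finally show ?thesis .
    qed
    then have "Q * (real L)\<^sup>2 * \<rho> ^ n * exp (l * h) \<le>
        Q * (real L)\<^sup>2 * (exp (- (l * h)) * (1 / real L ^ 4)) * exp (l * h)"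
      using m by (intro mult_right_mono mult_left_mono) auto
    also have "\<dots> = Q / (real L)\<^sup>2"
      using Lpos by (simp add: exp_minus field_simps power2_eq_square power4_eq_xxxx)
    also have "\<dots> \<le> 1 / real L"
    proof -
      have "Q * real L \<le> real L * real L" using c L Lpos by (intro mult_right_mono) auto
      then show ?thesis using Lpos by (simp add: field_simps power2_eq_square)
    qed
    also have "\<dots> < \<epsilon>"
      using cL c Lpos by (simp add: divide_less_eq)
    finally have "ereal_of_enat (rbb_tmix L \<nu> \<eta> \<epsilon>) \<le> ereal (real (m * n))"
      by (rule rbb_tmix_le)
    also have "real (m * n) \<le> c * (h + ln (real L) powr c)"
    proof -
      have "real (m * n) \<le> real m * (a + 1)" using n by (simp add: mult_left_mono)
      also have "\<dots> = real m * l / \<kappa> * h + real m * (4 / \<kappa> * ln (real L) + 1)"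
        by (simp add: a_def add_divide_distrib algebra_simps)
      also have "\<dots> \<le> real m * l / \<kappa> * h + real m * (4 / \<kappa> * ln (real L) + ln (real L))"
        using ln1 by (intro add_left_mono mult_left_mono) auto
      also have "\<dots> = real m * l / \<kappa> * h + real m * (4 / \<kappa> + 1) * ln (real L)"
        by (simp add: algebra_simps)
      also have "\<dots> \<le> c * h + c * ln (real L)"
        using c h ln1 by (intro add_mono mult_right_mono) auto
      also have "\<dots> \<le> c * h + c * ln (real L) powr c"
      proof -
        have "ln (real L) powr 1 \<le> ln (real L) powr c" using ln1 c by (intro powr_mono) auto
        then have "ln (real L) \<le> ln (real L) powr c" using ln1 by simp
        then show ?thesis using c by (intro add_left_mono mult_left_mono) auto
      qed
      finally show ?thesis by (simp add: distrib_left)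
    qed
    finally show "ereal_of_enat (rbb_tmix L \<nu> \<eta> \<epsilon>)
           \<le> ereal (c * (real (max_occupancy L \<eta>) + ln (real L) powr c))"
      by (simp add: h_def)
  qed
qed

end
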